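(* Let $G$ be a simple graph on $n$ vertices with $k>1$ connected components, and let $\Phi=\{\phi_i\}_{i\in[n]}$ be an $L_G(n,n-k)$-frame for $\mathbb{C}^{n-k}$ with frame operator $S_\Phi$. Then, for any $r\in[n-1]$, the canonical dual frame $S_\Phi^{-1}\Phi$ is a non-unique $SOD$-frame of $\Phi$ for $r$-erasures; that is, $S_\Phi^{-1}\Phi$ is an $SOD$-frame of $\Phi$ for $r$-erasures and there is a dual frame of $\Phi$ different from $S_\Phi^{-1}\Phi$ that is also an $SOD$-frame of $\Phi$ for $r$-erasures.
   Context: $[n]=\{1,\dots,n\}$. A finite sequence $\Phi=\{\phi_i\}_{i\in[n]}$ in $\mathbb{C}^m$ is a frame for $\mathbb{C}^m$ if there are constants $0<A\le B$ with $A\|f\|^2\le\sum_{i\in[n]}|\langle f,\phi_i\rangle|^2\le B\|f\|^2$ for all $f\in\mathbb{C}^m$ (inner product linear in the first argument). Its frame operator is $S_\Phi f=\sum_{i\in[n]}\langle f,\phi_i\rangle\phi_i$, which is invertible. A frame $\Psi=\{\psi_i\}_{i\in[n]}$ for $\mathbb{C}^m$ is a dual frame of $\Phi$ if $f=\sum_{i\in[n]}\langle f,\phi_i\rangle\psi_i=\sum_{i\in[n]}\langle f,\psi_i\rangle\phi_i$ for all $f\in\mathbb{C}^m$; $D_\Phi$ denotes the set of all dual frames of $\Phi$. The canonical dual frame is $S_\Phi^{-1}\Phi=\{S_\Phi^{-1}\phi_i\}_{i\in[n]}$. For a frame $\Phi$, $\Psi\in D_\Phi$ and $\Lambda\subset[n]$,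 the error operator is $E_{\Phi,\Psi,\Lambda}:\mathbb{C}^m\to\mathbb{C}^m$, $E_{\Phi,\Psi,\Lambda}(f)=\sum_{i\in\Lambda}\langle f,\phi_i\rangle\psi_i$. For $1\le r<n$, $\rho^{(r)}_{\Phi,\Psi}=\max\{\rho(E_{\Phi,\Psi,\Lambda}):\Lambda\subset[n],\ |\Lambda|=r\}$, where $\rho(\cdot)$ denotes the spectral radius. $SOD$-frames (spectrally optimal dual frames) are defined inductively: $\Psi\in D_\Phi$ is an $SOD$-frame of $\Phi$ for $1$-erasure if $\rho^{(1)}_{\Phi,\Psi}=\min\{\rho^{(1)}_{\Phi,\widetilde\Psi}:\widetilde\Psi\in D_\Phi\}$; for $1<r<n$, $\Psi\in D_\Phi$ is an $SOD$-frame of $\Phi$ for $r$-erasures if it is an $SOD$-frame of $\Phi$ for $(r-1)$-erasures and $\rho^{(r)}_{\Phi,\Psi}=\min\{\rho^{(r)}_{\Phi,\widetilde\Psi}:\widetilde\Psi\in D_\Phi\}$ (the minimum being over all dual frames of $\Phi$). For a simple graph $G$ with vertices $v_1,\dots,v_n$, the Laplacian matrix is $L=D-A$, with $D$ the diagonal matrix of vertex degrees and $A$ the adjacency matrix. It is positive semidefinite, and if $G$ has $n-m$ connected components then $L$ has rank $m$. $L_G(n,m)$-frame: let $G$ be a simple graph on $n$ vertices with $n-m$ connected components, and write $L=M\,\mathrm{diag}(\lambda_1,\dots,\lambda_m,0,\dots,0)\,M^*$ with $M$ an $n\times n$ unitary matrix and $\lambda_1,\dots,\lambda_m$ the nonzero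 eigenvalues of $L$ (with multiplicity). Let $M_1$ be the submatrix of $M$ formed by its first $m$ columns, $B=\mathrm{diag}(\sqrt{\lambda_1},\dots,\sqrt{\lambda_m})M_1^*$, and $\{e_i\}_{i\in[n]}$ the standard basis of $\mathbb{C}^n$. Then $\{Be_i\}_{i\in[n]}$ is a frame for $\mathbb{C}^m$; any frame arising in this way is called an $L_G(n,m)$-frame for $\mathbb{C}^m$. *)

theory Defs
  imports
    "Jordan_Normal_Form.Schur_Decomposition"
    "Jordan_Normal_Form.Spectral_Radius"
    "Graph_Theory.Graph_Theory"
begin

text \<open>
  A finite sequence of vectors of \<open>\<complex>\<^sup>m\<close> is a list of elements of \<open>carrier_vec m\<close>; its indices
  are \<open>0, \<dots>, n - 1\<close> instead of \<open>1, \<dots>, n\<close>.  The inner product \<open>f \<bullet>c g\<close> is linear in \<open>f\<close> and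
  conjugate linear in \<open>g\<close>.
\<close>

definition is_frame :: "nat \<Rightarrow> complex vec list \<Rightarrow> bool" where
  "is_frame m \<Phi> \<longleftrightarrow>
     set \<Phi> \<subseteq> carrier_vec m \<and>
     (\<exists>A B :: real. 0 < A \<and> A \<le> B \<and>
        (\<forall>f \<in> carrier_vec m.
           A * (\<Sum>j<m. (cmod (f $ j))\<^sup>2) \<le> (\<Sum>i<length \<Phi>. (cmod (f \<bullet>c \<Phi> ! i))\<^sup>2) \<and>
           (\<Sum>i<length \<Phi>. (cmod (f \<bullet>c \<Phi> ! i))\<^sup>2) \<le> B * (\<Sum>j<m. (cmod (f $ j))\<^sup>2)))"

definition error_op ::
  "nat \<Rightarrow> complex vec list \<Rightarrow> complex vec list \<Rightarrow> nat set \<Rightarrow> complex vec \<Rightarrow> complex vec" where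
  "error_op m \<Phi> \<Psi> \<Lambda> f = finsum_vec TYPE(complex) m (\<lambda>i. (f \<bullet>c \<Phi> ! i) \<cdot>\<^sub>v \<Psi> ! i) \<Lambda>"

definition frame_op :: "nat \<Rightarrow> complex vec list \<Rightarrow> complex vec \<Rightarrow> complex vec" where
  "frame_op m \<Phi> f = finsum_vec TYPE(complex) m (\<lambda>i. (f \<bullet>c \<Phi> ! i) \<cdot>\<^sub>v \<Phi> ! i) {..<length \<Phi>}"

definition dual_frames :: "nat \<Rightarrow> complex vec list \<Rightarrow> complex vec list set" where
  "dual_frames m \<Phi> =
     {\<Psi>. is_frame m \<Psi> \<and> length \<Psi> = length \<Phi> \<and>
        (\<forall>f \<in> carrier_vec m.
           f = finsum_vec TYPE(complex) m (\<lambda>i. (f \<bullet>c \<Phi> ! i) \<cdot>\<^sub>v \<Psi> ! i) {..<length \<Phi>} \<and>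
           f = finsum_vec TYPE(complex) m (\<lambda>i. (f \<bullet>c \<Psi> ! i) \<cdot>\<^sub>v \<Phi> ! i) {..<length \<Phi>})}"

definition canonical_dual :: "nat \<Rightarrow> complex vec list \<Rightarrow> complex vec list" where
  "canonical_dual m \<Phi> = map (inv_into (carrier_vec m) (frame_op m \<Phi>)) \<Phi>"

text \<open>The matrix, in the standard basis, of a linear operator on \<open>\<complex>\<^sup>m\<close>.\<close>

definition op_mat :: "nat \<Rightarrow> (complex vec \<Rightarrow> complex vec) \<Rightarrow> complex mat" where
  "op_mat m T = mat m m (\<lambda>(i, j). T (unit_vec m j) $ i)"

definition erasure_radius ::
  "nat \<Rightarrow> nat \<Rightarrow> complex vec list \<Rightarrow> complex vec list \<Rightarrow> real" where
  "erasure_radius m r \<Phi> \<Psi> =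
     Max {spectral_radius (op_mat m (error_op m \<Phi> \<Psi> \<Lambda>)) | \<Lambda>.
            \<Lambda> \<subseteq> {..<length \<Phi>} \<and> card \<Lambda> = r}"

inductive SOD_frame :: "nat \<Rightarrow> complex vec list \<Rightarrow> nat \<Rightarrow> complex vec list \<Rightarrow> bool"
  for m :: nat and \<Phi> :: "complex vec list" where
  one: "1 < length \<Phi> \<Longrightarrow>
        is_arg_min (erasure_radius m 1 \<Phi>) (\<lambda>\<Psi>'. \<Psi>' \<in> dual_frames m \<Phi>) \<Psi> \<Longrightarrow>
        SOD_frame m \<Phi> 1 \<Psi>"
| step: "1 < r \<Longrightarrow> r < length \<Phi> \<Longrightarrow> SOD_frame m \<Phi> (r - 1) \<Psi> \<Longrightarrow>
        is_arg_min (erasure_radius m r \<Phi>) (\<lambda>\<Psi>'. \<Psi>' \<in> dual_frames m \<Phi>) \<Psi> \<Longrightarrow>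
        SOD_frame m \<Phi> r \<Psi>"

text \<open>
  Simple graphs are the finite, symmetric, loop-free digraphs without parallel arcs (locale
  \<^locale>\<open>graph\<close>), each edge being a pair of opposite arcs.  Hence the degree of a vertex is its
  out-degree, and the connected components are the strongly connected ones.  The list \<open>vs\<close>
  enumerates the vertices.
\<close>

definition laplacian :: "('a, 'b) pre_digraph \<Rightarrow> 'a list \<Rightarrow> complex mat" where
  "laplacian G vs =
     mat_diag (length vs) (\<lambda>i. of_nat (out_degree G (vs ! i))) -
     mat (length vs) (length vs) (\<lambda>(i, j). if (vs ! i, vs ! j) \<in> arcs_ends G then 1 else 0)"

definition unitary_mat :: "nat \<Rightarrow> complex mat \<Rightarrow> bool" where
  "unitary_mat n M \<longleftrightarrow>
     M \<in> carrier_mat n n \<and> M * mat_adjoint M = 1\<^sub>m n \<and> mat_adjoint M * M = 1\<^sub>m n"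

text \<open>
  The \<open>ev i\<close> for \<open>i < m\<close> are the nonzero eigenvalues of the Laplacian with multiplicity, in the
  order given by the columns of \<open>M\<close>; they are positive because the Laplacian is positive
  semidefinite.
\<close>

definition LG_frame ::
  "('a, 'b) pre_digraph \<Rightarrow> 'a list \<Rightarrow> nat \<Rightarrow> nat \<Rightarrow> complex vec list \<Rightarrow> bool" where
  "LG_frame G vs n m \<Phi> \<longleftrightarrow>
     graph G \<and> distinct vs \<and> set vs = verts G \<and> length vs = n \<and>
     m \<le> n \<and> card (pre_digraph.sccs G) = n - m \<and>
     (\<exists>(M :: complex mat) (ev :: nat \<Rightarrow> real).
        unitary_mat n M \<and>
        (\<forall>i<m. ev i \<noteq> 0) \<and>
        laplacian G vs =
          M * mat_diag n (\<lambda>i. if i < m then complex_of_real (ev i) else 0) * mat_adjoint M \<and>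
        (let M1 = mat n m (\<lambda>(i, j). M $$ (i, j));
             B = mat_diag m (\<lambda>i. complex_of_real (sqrt (ev i))) * mat_adjoint M1
         in \<Phi> = map (\<lambda>i. B *\<^sub>v unit_vec n i) [0..<n]))"

end

theory Submission
  imports Defs "HOL-Analysis.Convex"
begin

text \<open>
  Let \<open>\<Theta>\<close> be the canonical dual.  Its cross Gram matrix with \<open>\<Phi>\<close> is the projection onto the
  complement of the kernel of the Laplacian, so \<open>\<langle>\<theta>\<^sub>j, \<phi>\<^sub>i\<rangle>\<close> is \<open>\<delta>\<^sub>i\<^sub>j\<close>, minus \<open>1 / card C\<close> if \<open>i\<close> and
  \<open>j\<close> lie in the same component \<open>C\<close>.  Every dual \<open>\<Psi>\<close> differs from \<open>\<Theta>\<close> by a vector constant on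
  components, and the frame vectors of a component sum to zero.  Hence the diagonal entries
  \<open>\<langle>\<psi>\<^sub>i, \<phi>\<^sub>i\<rangle>\<close> over \<open>C\<close> have the mean \<open>1 - 1 / card C\<close> for every dual, which is the case \<open>r = 1\<close>; and if \<open>i\<close>
  and \<open>j\<close> lie in the same component and both are erased, then \<open>\<psi>\<^sub>i - \<psi>\<^sub>j\<close> is fixed by the error operator,
  so no dual has radius below \<open>1\<close> for \<open>r \<ge> 2\<close>.  The canonical dual attains these bounds, and so does its
  perturbation by \<open>\<theta>\<^sub>i\<close> on a component not containing \<open>i\<close>.
\<close>

section \<open>Dual frames and error operators in coordinates\<close>

lemma cscalar_sum:
  assumes "g \<in> carrier_vec m"
  shows "f \<bullet>c g = (\<Sum>p<m. f $ p * cnj (g $ p))"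
  using assms by (simp add: scalar_prod_def lessThan_atLeast0)

text \<open>The operator identity \<open>\<Psi> \<Phi>^* = I\<close>, entry by entry. Duality
  thereby becomes a finite system of scalar equations in which no frame bounds appear.\<close>

definition biorthogonal :: "nat \<Rightarrow> complex vec list \<Rightarrow> complex vec list \<Rightarrow> bool" where
  "biorthogonal m \<Phi> \<Psi> \<longleftrightarrow>
     (\<forall>p<m. \<forall>q<m. (\<Sum>i<length \<Phi>. cnj (\<Phi> ! i $ q) * \<Psi> ! i $ p) = (if p = q then 1 else 0))"

text \<open>Taking adjoints turns \<open>\<Psi> \<Phi>^* = I\<close> into
  \<open>\<Phi> \<Psi>^* = I\<close>, so one of the two reconstruction formulas implies the
  other.\<close>

lemma biorthogonal_sym:
  assumes "biorthogonal m \<Phi> \<Psi>" "length \<Psi> = length \<Phi>"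
  shows "biorthogonal m \<Psi> \<Phi>"
  unfolding biorthogonal_def
proof (intro allI impI)
  fix p q assume "p < m" "q < m"
  then have "(\<Sum>i<length \<Phi>. cnj (\<Phi> ! i $ p) * \<Psi> ! i $ q) = (if q = p then 1 else 0)"
    using assms unfolding biorthogonal_def by blast
  then have "cnj (\<Sum>i<length \<Phi>. cnj (\<Phi> ! i $ p) * \<Psi> ! i $ q) = (if p = q then 1 else 0)"
    by auto
  then show "(\<Sum>i<length \<Psi>. cnj (\<Psi> ! i $ q) * \<Phi> ! i $ p) = (if p = q then 1 else 0)"
    using assms(2) by (simp add: mult.commute)
qed

lemma sum_cscalar_swap:
  assumes "\<And>i. i \<in> I \<Longrightarrow> \<Phi> ! i \<in> carrier_vec m"
  shows "(\<Sum>i\<in>I. (f \<bullet>c \<Phi> ! i) * x i) = (\<Sum>q<m. f $ q * (\<Sum>i\<in>I. cnj (\<Phi> ! i $ q) * x i))"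
proof -
  have "(\<Sum>i\<in>I. (f \<bullet>c \<Phi> ! i) * x i) = (\<Sum>i\<in>I. \<Sum>q<m. f $ q * cnj (\<Phi> ! i $ q) * x i)"
    using assms by (intro sum.cong refl) (simp add: cscalar_sum[where m = m] sum_distrib_right)
  also have "\<dots> = (\<Sum>q<m. \<Sum>i\<in>I. f $ q * cnj (\<Phi> ! i $ q) * x i)"
    by (rule sum.swap)
  finally show ?thesis by (simp add: sum_distrib_left mult.assoc)
qed

lemma biorthogonal_reconstruct:
  assumes "biorthogonal m \<Phi> \<Psi>" "set \<Phi> \<subseteq> carrier_vec m" "p < m"
  shows "(\<Sum>i<length \<Phi>. (f \<bullet>c \<Phi> ! i) * \<Psi> ! i $ p) = f $ p"
proof -
  have "(\<Sum>i<length \<Phi>. (f \<bullet>c \<Phi> ! i) * \<Psi> ! i $ p)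
      = (\<Sum>q<m. f $ q * (\<Sum>i<length \<Phi>. cnj (\<Phi> ! i $ q) * \<Psi> ! i $ p))"
    using assms(2) by (intro sum_cscalar_swap) (auto simp: subset_iff)
  also have "\<dots> = (\<Sum>q<m. if q = p then f $ q else 0)"
    using assms(1,3) unfolding biorthogonal_def by (intro sum.cong refl) auto
  finally show ?thesis using assms(3) by simp
qed

lemma cscalar_unit_vec:
  assumes "g \<in> carrier_vec m" "q < m"
  shows "unit_vec m q \<bullet>c g = cnj (g $ q)"
proof -
  have "unit_vec m q \<bullet>c g = (\<Sum>p<m. if p = q then cnj (g $ p) else 0)"
    unfolding cscalar_sum[OF assms(1)] using assms(2) by (intro sum.cong) auto
  then show ?thesis using assms(2) by simp
qed

lemma finsum_vec_frame_index:
  assumes "I \<subseteq> {..<length \<Psi>}" "set \<Psi> \<subseteq> carrier_vec m" "p < m"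
  shows "finsum_vec TYPE(complex) m (\<lambda>i. c i \<cdot>\<^sub>v \<Psi> ! i) I $ p = (\<Sum>i\<in>I. c i * \<Psi> ! i $ p)"
proof -
  have *: "\<Psi> ! i \<in> carrier_vec m" if "i \<in> I" for i
    using assms(1,2) that nth_mem by blast
  show ?thesis
    using assms(3) * finite_subset[OF assms(1)]
    by (subst index_finsum_vec) (auto intro!: sum.cong simp: carrier_vecD[OF *])
qed

lemma finsum_vec_frame_closed:
  assumes "I \<subseteq> {..<length \<Psi>}" "set \<Psi> \<subseteq> carrier_vec m"
  shows "finsum_vec TYPE(complex) m (\<lambda>i. c i \<cdot>\<^sub>v \<Psi> ! i) I \<in> carrier_vec m"
  using assms by (intro finsum_vec_closed) (auto simp: subset_iff)

text \<open>The lower bound is Cauchy-Schwarz applied to the reconstruction of each coordinate of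
  \<open>f\<close> from its coefficients; the upper bound is Cauchy-Schwarz applied to each
  coefficient.\<close>

lemma biorthogonal_is_frame:
  assumes bi: "biorthogonal m \<Psi> \<Phi>" and car: "set \<Psi> \<subseteq> carrier_vec m"
  shows "is_frame m \<Psi>"
proof -
  let ?n = "length \<Psi>"
  let ?E = "\<lambda>f. \<Sum>i<?n. (cmod (f \<bullet>c \<Psi> ! i))\<^sup>2"
  define K where "K = (\<Sum>p<m. \<Sum>i<?n. (cmod (\<Phi> ! i $ p))\<^sup>2)"
  define B where "B = (\<Sum>i<?n. \<Sum>p<m. (cmod (\<Psi> ! i $ p))\<^sup>2)"
  have K: "0 \<le> K" unfolding K_def by (intro sum_nonneg) auto
  have B: "0 \<le> B" unfolding B_def by (intro sum_nonneg) auto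
  have carn: "\<Psi> ! i \<in> carrier_vec m" if "i < ?n" for i using car that by auto
  have cs: "(cmod (\<Sum>i\<in>I. a i * b i))\<^sup>2 \<le> (\<Sum>i\<in>I. (cmod (a i))\<^sup>2) * (\<Sum>i\<in>I. (cmod (b i))\<^sup>2)"
    for I :: "nat set" and a b :: "nat \<Rightarrow> complex"
  proof -
    have "cmod (\<Sum>i\<in>I. a i * b i) \<le> (\<Sum>i\<in>I. cmod (a i) * cmod (b i))"
      by (rule order_trans[OF norm_sum]) (simp add: norm_mult)
    then have "(cmod (\<Sum>i\<in>I. a i * b i))\<^sup>2 \<le> (\<Sum>i\<in>I. cmod (a i) * cmod (b i))\<^sup>2"
      by (intro power_mono) auto
    also have "\<dots> \<le> (\<Sum>i\<in>I. (cmod (a i))\<^sup>2) * (\<Sum>i\<in>I. (cmod (b i))\<^sup>2)"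
      by (rule Cauchy_Schwarz_ineq_sum)
    finally show ?thesis .
  qed
  have lower: "(\<Sum>p<m. (cmod (f $ p))\<^sup>2) \<le> ?E f * K" for f
  proof -
    have "(cmod (f $ p))\<^sup>2 \<le> ?E f * (\<Sum>i<?n. (cmod (\<Phi> ! i $ p))\<^sup>2)" if "p < m" for p
      using cs[of "\<lambda>i. f \<bullet>c \<Psi> ! i" "\<lambda>i. \<Phi> ! i $ p" "{..<?n}"]
        biorthogonal_reconstruct[OF bi car that, of f] by simp
    then show ?thesis
      unfolding K_def sum_distrib_left by (intro sum_mono) auto
  qed
  have upper: "?E f \<le> B * (\<Sum>p<m. (cmod (f $ p))\<^sup>2)" for f
  proof -
    have "(cmod (f \<bullet>c \<Psi> ! i))\<^sup>2 \<le> (\<Sum>p<m. (cmod (\<Psi> ! i $ p))\<^sup>2) * (\<Sum>p<m. (cmod (f $ p))\<^sup>2)"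
      if "i < ?n" for i
      using cs[of "\<lambda>p. f $ p" "\<lambda>p. cnj (\<Psi> ! i $ p)" "{..<m}"] carn[OF that]
      by (simp add: cscalar_sum mult.commute)
    then show ?thesis
      unfolding B_def sum_distrib_right by (intro sum_mono) auto
  qed
  \<comment> \<open>Adding 1 avoids division by zero when \<open>K = 0\<close>; taking
    \<open>B + ?A\<close> as the upper constant makes the constants positive and ordered at
    once.\<close>
  let ?A = "1 / (K + 1)"
  have "?A * (\<Sum>p<m. (cmod (f $ p))\<^sup>2) \<le> ?E f" for f
  proof -
    have "0 \<le> ?E f" by (intro sum_nonneg) auto
    then have "?E f * K \<le> ?E f * (K + 1)" by (simp add: algebra_simps)
    then show ?thesis using lower[of f] K by (simp add: field_simps)
  qed
  moreover have "?E f \<le> (B + ?A) * (\<Sum>p<m. (cmod (f $ p))\<^sup>2)" for f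
  proof -
    have "0 \<le> ?A * (\<Sum>p<m. (cmod (f $ p))\<^sup>2)" using K by (intro mult_nonneg_nonneg sum_nonneg) auto
    then show ?thesis using upper[of f] by (simp add: distrib_right)
  qed
  moreover have "0 < ?A" "?A \<le> B + ?A" using K B by auto
  ultimately show ?thesis
    unfolding is_frame_def using car by blast
qed

text \<open>Reconstructing the unit vectors yields the matrix entries. Conversely the adjoint
  identity supplies the second formula, and the frame bounds come for free from
  biorthogonality.\<close>

lemma dual_frames_iff:
  assumes car: "set \<Phi> \<subseteq> carrier_vec m"
  shows "\<Psi> \<in> dual_frames m \<Phi> \<longleftrightarrow>
    length \<Psi> = length \<Phi> \<and> set \<Psi> \<subseteq> carrier_vec m \<and> biorthogonal m \<Phi> \<Psi>"
proof
  assume *: "\<Psi> \<in> dual_frames m \<Phi>"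
  then have len: "length \<Psi> = length \<Phi>" and carP: "set \<Psi> \<subseteq> carrier_vec m"
    and rec: "\<And>f. f \<in> carrier_vec m \<Longrightarrow>
      f = finsum_vec TYPE(complex) m (\<lambda>i. (f \<bullet>c \<Phi> ! i) \<cdot>\<^sub>v \<Psi> ! i) {..<length \<Phi>}"
    unfolding dual_frames_def is_frame_def by auto
  have "(\<Sum>i<length \<Phi>. cnj (\<Phi> ! i $ q) * \<Psi> ! i $ p) = (if p = q then 1 else 0)"
    if "p < m" "q < m" for p q
  proof -
    have "unit_vec m q $ p
        = finsum_vec TYPE(complex) m (\<lambda>i. (unit_vec m q \<bullet>c \<Phi> ! i) \<cdot>\<^sub>v \<Psi> ! i) {..<length \<Phi>} $ p"
      using rec[of "unit_vec m q"] by simp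
    also have "\<dots> = (\<Sum>i<length \<Phi>. (unit_vec m q \<bullet>c \<Phi> ! i) * \<Psi> ! i $ p)"
      using len carP that by (intro finsum_vec_frame_index) auto
    also have "\<dots> = (\<Sum>i<length \<Phi>. cnj (\<Phi> ! i $ q) * \<Psi> ! i $ p)"
    proof (intro sum.cong refl)
      fix i assume "i \<in> {..<length \<Phi>}"
      then have "\<Phi> ! i \<in> carrier_vec m" using car by auto
      then show "(unit_vec m q \<bullet>c \<Phi> ! i) * \<Psi> ! i $ p = cnj (\<Phi> ! i $ q) * \<Psi> ! i $ p"
        using that by (simp only: cscalar_unit_vec)
    qed
    finally show ?thesis using that by simp
  qed
  then show "length \<Psi> = length \<Phi> \<and> set \<Psi> \<subseteq> carrier_vec m \<and> biorthogonal m \<Phi> \<Psi>"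
    using len carP unfolding biorthogonal_def by blast
next
  assume *: "length \<Psi> = length \<Phi> \<and> set \<Psi> \<subseteq> carrier_vec m \<and> biorthogonal m \<Phi> \<Psi>"
  then have len: "length \<Psi> = length \<Phi>" and carP: "set \<Psi> \<subseteq> carrier_vec m"
    and bi: "biorthogonal m \<Phi> \<Psi>" by auto
  have bi': "biorthogonal m \<Psi> \<Phi>" using biorthogonal_sym[OF bi len] .
  have "f = finsum_vec TYPE(complex) m (\<lambda>i. (f \<bullet>c \<Phi> ! i) \<cdot>\<^sub>v \<Psi> ! i) {..<length \<Phi>} \<and>
     f = finsum_vec TYPE(complex) m (\<lambda>i. (f \<bullet>c \<Psi> ! i) \<cdot>\<^sub>v \<Phi> ! i) {..<length \<Phi>}"
    (is "f = ?x \<and> f = ?y") if f: "f \<in> carrier_vec m" for f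
  proof -
    have x: "?x \<in> carrier_vec m" and y: "?y \<in> carrier_vec m"
      using len carP car by (auto intro!: finsum_vec_frame_closed)
    have 1: "f $ p = ?x $ p" if "p < m" for p
      using biorthogonal_reconstruct[OF bi car that, of f] len carP that
      by (subst finsum_vec_frame_index) auto
    have 2: "f $ p = ?y $ p" if "p < m" for p
      using biorthogonal_reconstruct[OF bi' carP that, of f] len car that
      by (subst finsum_vec_frame_index) auto
    show ?thesis
    proof
      show "f = ?x" using 1 carrier_vecD[OF f] carrier_vecD[OF x] by (intro eq_vecI) simp_all
      show "f = ?y" using 2 carrier_vecD[OF f] carrier_vecD[OF y] by (intro eq_vecI) simp_all
    qed
  qed
  then show "\<Psi> \<in> dual_frames m \<Phi>"
    unfolding dual_frames_def using len biorthogonal_is_frame[OF bi' carP] by blast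
qed

section \<open>Matrices and eigenvalue equations of error operators\<close>

lemma op_mat_error_op_index:
  assumes "length \<Psi> = length \<Phi>" "set \<Phi> \<subseteq> carrier_vec m" "set \<Psi> \<subseteq> carrier_vec m"
    "\<Lambda> \<subseteq> {..<length \<Phi>}" "p < m" "q < m"
  shows "op_mat m (error_op m \<Phi> \<Psi> \<Lambda>) $$ (p, q) = (\<Sum>i\<in>\<Lambda>. cnj (\<Phi> ! i $ q) * \<Psi> ! i $ p)"
proof -
  have "(unit_vec m q \<bullet>c \<Phi> ! i) = cnj (\<Phi> ! i $ q)" if "i \<in> \<Lambda>" for i
    using assms(2,4,6) that nth_mem by (intro cscalar_unit_vec) blast+
  then show ?thesis
    using assms by (simp add: op_mat_def error_op_def finsum_vec_frame_index)
qed

lemma op_mat_error_op_mult: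
  assumes "length \<Psi> = length \<Phi>" "set \<Phi> \<subseteq> carrier_vec m" "set \<Psi> \<subseteq> carrier_vec m"
    "\<Lambda> \<subseteq> {..<length \<Phi>}" "p < m" "v \<in> carrier_vec m"
  shows "(op_mat m (error_op m \<Phi> \<Psi> \<Lambda>) *\<^sub>v v) $ p = (\<Sum>i\<in>\<Lambda>. (v \<bullet>c \<Phi> ! i) * \<Psi> ! i $ p)"
proof -
  have d: "dim_row (op_mat m (error_op m \<Phi> \<Psi> \<Lambda>)) = m" "dim_col (op_mat m (error_op m \<Phi> \<Psi> \<Lambda>)) = m"
    by (auto simp: op_mat_def)
  have "(op_mat m (error_op m \<Phi> \<Psi> \<Lambda>) *\<^sub>v v) $ p
     = (\<Sum>q<m. op_mat m (error_op m \<Phi> \<Psi> \<Lambda>) $$ (p, q) * v $ q)"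
    using assms(5,6) d by (simp add: scalar_prod_def lessThan_atLeast0)
  also have "\<dots> = (\<Sum>q<m. v $ q * (\<Sum>i\<in>\<Lambda>. cnj (\<Phi> ! i $ q) * \<Psi> ! i $ p))"
    by (intro sum.cong refl) (simp add: op_mat_error_op_index[OF assms(1-5)] mult.commute)
  also have "\<dots> = (\<Sum>i\<in>\<Lambda>. (v \<bullet>c \<Phi> ! i) * \<Psi> ! i $ p)"
    using assms(2,4) nth_mem by (intro sum_cscalar_swap[symmetric]) blast
  finally show ?thesis .
qed

lemma eigenvalue_error_op_iff:
  assumes "length \<Psi> = length \<Phi>" "set \<Phi> \<subseteq> carrier_vec m" "set \<Psi> \<subseteq> carrier_vec m"
    "\<Lambda> \<subseteq> {..<length \<Phi>}"
  shows "eigenvalue (op_mat m (error_op m \<Phi> \<Psi> \<Lambda>)) \<mu> \<longleftrightarrow>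
    (\<exists>v \<in> carrier_vec m. v \<noteq> 0\<^sub>v m \<and>
      (\<forall>p<m. (\<Sum>i\<in>\<Lambda>. (v \<bullet>c \<Phi> ! i) * \<Psi> ! i $ p) = \<mu> * v $ p))"
proof -
  let ?E = "op_mat m (error_op m \<Phi> \<Psi> \<Lambda>)"
  have d: "dim_row ?E = m" "dim_col ?E = m" by (auto simp: op_mat_def)
  have "?E *\<^sub>v v = \<mu> \<cdot>\<^sub>v v \<longleftrightarrow> (\<forall>p<m. (\<Sum>i\<in>\<Lambda>. (v \<bullet>c \<Phi> ! i) * \<Psi> ! i $ p) = \<mu> * v $ p)"
    if v: "v \<in> carrier_vec m" for v
  proof -
    have "?E *\<^sub>v v = \<mu> \<cdot>\<^sub>v v \<longleftrightarrow> (\<forall>p<m. (?E *\<^sub>v v) $ p = (\<mu> \<cdot>\<^sub>v v) $ p)"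
      using d carrier_vecD[OF v] by (auto simp: vec_eq_iff simp del: index_mult_mat_vec)
    then show ?thesis
      using op_mat_error_op_mult[OF assms _ v] carrier_vecD[OF v] by auto
  qed
  then show ?thesis unfolding eigenvalue_def eigenvector_def d by blast
qed

section \<open>Bounds on spectral radii and erasure radii\<close>

lemma spectral_radius_leI:
  assumes "A \<in> carrier_mat m m" "0 < m" "\<And>\<mu>. eigenvalue A \<mu> \<Longrightarrow> cmod \<mu> \<le> X"
  shows "spectral_radius A \<le> X"
  using spectral_radius_mem_max(1)[OF assms(1,2)] assms(3) by (auto simp: spectrum_def)

lemma spectral_radius_geI:
  assumes "A \<in> carrier_mat m m" "0 < m" "eigenvalue A \<mu>"
  shows "cmod \<mu> \<le> spectral_radius A"
  using spectral_radius_mem_max(2)[OF assms(1,2)] assms(3) by (auto simp: spectrum_def)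

lemma spectral_radius_nonneg:
  assumes "A \<in> carrier_mat m m" "0 < m"
  shows "0 \<le> spectral_radius A"
  using spectral_radius_mem_max(1)[OF assms] by auto

lemma erasure_radius_leI:
  assumes "r \<le> length \<Phi>"
    "\<And>\<Lambda>. \<Lambda> \<subseteq> {..<length \<Phi>} \<Longrightarrow> card \<Lambda> = r \<Longrightarrow>
      spectral_radius (op_mat m (error_op m \<Phi> \<Psi> \<Lambda>)) \<le> X"
  shows "erasure_radius m r \<Phi> \<Psi> \<le> X"
proof -
  let ?S = "{\<Lambda>. \<Lambda> \<subseteq> {..<length \<Phi>} \<and> card \<Lambda> = r}"
  have fin: "finite ?S" by simp
  \<comment> \<open>The family of erasure sets must be nonempty for \<open>Max\<close> to be
    meaningful.\<close>
  have "{..<r} \<in> ?S" using assms(1) by auto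
  then have "?S \<noteq> {}" by blast
  then show ?thesis
    unfolding erasure_radius_def Setcompr_eq_image using fin assms(2) by (subst Max_le_iff) auto
qed

lemma erasure_radius_geI:
  assumes "\<Lambda> \<subseteq> {..<length \<Phi>}" "card \<Lambda> = r"
  shows "spectral_radius (op_mat m (error_op m \<Phi> \<Psi> \<Lambda>)) \<le> erasure_radius m r \<Phi> \<Psi>"
  unfolding erasure_radius_def using assms by (intro Max_ge) (auto simp: Setcompr_eq_image)

text \<open>Pairing the eigenvalue equation of \<open>v\<close> with each frame vector gives an
  equation for the coefficients \<open>c i\<close> of \<open>v\<close> alone. For
  \<open>\<mu> \<noteq> 0\<close> the coefficients on \<open>\<Lambda>\<close> determine
  \<open>v\<close>, so they cannot all vanish. Nonzero eigenvalues are thus governed by the cross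
  Gram matrix of \<open>\<Psi>\<close> and \<open>\<Phi>\<close>.\<close>

lemma eigenvalue_error_op_coeffs:
  assumes "length \<Psi> = length \<Phi>" "set \<Phi> \<subseteq> carrier_vec m" "set \<Psi> \<subseteq> carrier_vec m"
    "\<Lambda> \<subseteq> {..<length \<Phi>}"
    and ev: "eigenvalue (op_mat m (error_op m \<Phi> \<Psi> \<Lambda>)) \<mu>" and "\<mu> \<noteq> 0"
  obtains c where "\<exists>l\<in>\<Lambda>. c l \<noteq> 0"
    and "\<And>l. l < length \<Phi> \<Longrightarrow> \<mu> * c l = (\<Sum>i\<in>\<Lambda>. c i * (\<Psi> ! i \<bullet>c \<Phi> ! l))"
proof -
  obtain v where v: "v \<in> carrier_vec m" "v \<noteq> 0\<^sub>v m"
    and E: "\<And>p. p < m \<Longrightarrow> (\<Sum>i\<in>\<Lambda>. (v \<bullet>c \<Phi> ! i) * \<Psi> ! i $ p) = \<mu> * v $ p"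
    using ev unfolding eigenvalue_error_op_iff[OF assms(1-4)] by blast
  define c where "c = (\<lambda>i. v \<bullet>c \<Phi> ! i)"
  have "\<exists>l\<in>\<Lambda>. c l \<noteq> 0"
  proof (rule ccontr)
    assume "\<not> ?thesis"
    then have "\<mu> * v $ p = 0" if "p < m" for p
      using E[OF that] by (simp add: c_def)
    then have "v = 0\<^sub>v m" using v(1) \<open>\<mu> \<noteq> 0\<close> by (intro eq_vecI) auto
    then show False using v(2) by simp
  qed
  moreover have "\<mu> * c l = (\<Sum>i\<in>\<Lambda>. c i * (\<Psi> ! i \<bullet>c \<Phi> ! l))" if "l < length \<Phi>" for l
  proof -
    have l: "\<Phi> ! l \<in> carrier_vec m" using that assms(2) by auto
    have "\<mu> * c l = (\<Sum>p<m. (\<mu> * v $ p) * cnj (\<Phi> ! l $ p))"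
      unfolding c_def cscalar_sum[OF l] by (simp add: sum_distrib_left mult.assoc)
    also have "\<dots> = (\<Sum>p<m. (\<Sum>i\<in>\<Lambda>. c i * \<Psi> ! i $ p) * cnj (\<Phi> ! l $ p))"
      by (intro sum.cong refl) (simp add: c_def E)
    also have "\<dots> = (\<Sum>p<m. \<Sum>i\<in>\<Lambda>. c i * (\<Psi> ! i $ p * cnj (\<Phi> ! l $ p)))"
      by (simp add: sum_distrib_right mult.assoc)
    also have "\<dots> = (\<Sum>i\<in>\<Lambda>. \<Sum>p<m. c i * (\<Psi> ! i $ p * cnj (\<Phi> ! l $ p)))"
      by (rule sum.swap)
    also have "\<dots> = (\<Sum>i\<in>\<Lambda>. c i * (\<Psi> ! i \<bullet>c \<Phi> ! l))"
      unfolding cscalar_sum[OF l] by (simp add: sum_distrib_left)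
    finally show ?thesis .
  qed
  ultimately show ?thesis by (rule that)
qed

text \<open>A single erasure gives an operator of rank at most one, for which
  \<open>\<Psi> ! j\<close> is an eigenvector as soon as the pairing is nonzero; otherwise
  nonnegativity of the radius suffices.\<close>

lemma spectral_radius_single_ge:
  assumes "length \<Psi> = length \<Phi>" "set \<Phi> \<subseteq> carrier_vec m" "set \<Psi> \<subseteq> carrier_vec m"
    "j < length \<Phi>" "0 < m"
  shows "cmod (\<Psi> ! j \<bullet>c \<Phi> ! j) \<le> spectral_radius (op_mat m (error_op m \<Phi> \<Psi> {j}))"
proof (cases "\<Psi> ! j \<bullet>c \<Phi> ! j = 0")
  case True
  then show ?thesis using assms(5) spectral_radius_nonneg[of "op_mat m (error_op m \<Phi> \<Psi> {j})" m]
    by (simp add: op_mat_def)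
next
  case False
  have c: "\<Psi> ! j \<in> carrier_vec m" "\<Phi> ! j \<in> carrier_vec m" using assms by auto
  have "\<Psi> ! j \<noteq> 0\<^sub>v m"
  proof
    assume "\<Psi> ! j = 0\<^sub>v m"
    then have "\<Psi> ! j \<bullet>c \<Phi> ! j = 0" using cscalar_sum[OF c(2)] by simp
    then show False using False by simp
  qed
  then have "eigenvalue (op_mat m (error_op m \<Phi> \<Psi> {j})) (\<Psi> ! j \<bullet>c \<Phi> ! j)"
    using assms c by (subst eigenvalue_error_op_iff) (auto intro!: bexI[of _ "\<Psi> ! j"])
  then show ?thesis
    using assms(5) by (intro spectral_radius_geI[where m = m]) (auto simp: op_mat_def)
qed

text \<open>For \<open>\<Lambda> = {j}\<close> the coefficient equation at \<open>j\<close> is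
  scalar, and cancelling \<open>c j\<close> leaves one possible nonzero eigenvalue.\<close>

lemma spectral_radius_single_le:
  assumes "length \<Psi> = length \<Phi>" "set \<Phi> \<subseteq> carrier_vec m" "set \<Psi> \<subseteq> carrier_vec m"
    "j < length \<Phi>" "0 < m"
  shows "spectral_radius (op_mat m (error_op m \<Phi> \<Psi> {j})) \<le> cmod (\<Psi> ! j \<bullet>c \<Phi> ! j)"
proof (rule spectral_radius_leI)
  fix \<mu> assume ev: "eigenvalue (op_mat m (error_op m \<Phi> \<Psi> {j})) \<mu>"
  show "cmod \<mu> \<le> cmod (\<Psi> ! j \<bullet>c \<Phi> ! j)"
  proof (cases "\<mu> = 0")
    case False
    have "{j} \<subseteq> {..<length \<Phi>}" using assms(4) by simp
    from eigenvalue_error_op_coeffs[OF assms(1-3) this ev False]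
    obtain c where "\<exists>l\<in>{j}. c l \<noteq> 0"
      and "\<And>l. l < length \<Phi> \<Longrightarrow> \<mu> * c l = (\<Sum>i\<in>{j}. c i * (\<Psi> ! i \<bullet>c \<Phi> ! l))"
      by blast
    then have "c j \<noteq> 0" "\<mu> * c j = c j * (\<Psi> ! j \<bullet>c \<Phi> ! j)"
      using assms(4) by simp_all
    then have "\<mu> = \<Psi> ! j \<bullet>c \<Phi> ! j" by simp
    then show ?thesis by simp
  qed simp
qed (use assms(5) in \<open>auto simp: op_mat_def\<close>)

section \<open>Frames with a block-averaging cross Gram matrix\<close>

text \<open>Collects what the optimality argument takes from the graph. \<open>comp\<close> labels
  indices by component, and the matrix in \<open>gram\<close> is the projection onto vectors whose
  sum over each block is zero. \<open>\<Theta>\<close> is an explicit candidate, identified with the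
  canonical dual in \<open>canonical_dual_eq\<close>.\<close>

locale component_frame =
  fixes m n :: nat and \<Phi> \<Theta> :: "complex vec list" and comp :: "nat \<Rightarrow> 'c"
  assumes m_pos: "0 < m"
    and len: "length \<Phi> = n" "length \<Theta> = n"
    and car: "set \<Phi> \<subseteq> carrier_vec m" "set \<Theta> \<subseteq> carrier_vec m"
    and bi: "biorthogonal m \<Phi> \<Theta>"
    and gram: "\<And>i j. i < n \<Longrightarrow> j < n \<Longrightarrow> \<Theta> ! j \<bullet>c \<Phi> ! i =
      (if i = j then 1 else 0) - (if comp i = comp j then 1 / of_nat (card {l. l < n \<and> comp l = comp i}) else 0)"
begin

section \<open>Block sums of the cross Gram matrix and of the frame\<close>

definition block :: "'c \<Rightarrow> nat set" where
  "block c = {l. l < n \<and> comp l = c}"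

lemma finite_block [simp]: "finite (block c)"
  by (simp add: block_def)

lemma block_less: "l \<in> block c \<Longrightarrow> l < n"
  by (auto simp: block_def)

lemma card_block_pos: "i < n \<Longrightarrow> 0 < card (block (comp i))"
  by (auto simp: card_gt_0_iff block_def)

lemma Phi_carrier: "i < n \<Longrightarrow> \<Phi> ! i \<in> carrier_vec m"
  and Theta_carrier: "i < n \<Longrightarrow> \<Theta> ! i \<in> carrier_vec m"
  using car len by auto

lemma gram_block:
  "i < n \<Longrightarrow> j < n \<Longrightarrow> \<Theta> ! j \<bullet>c \<Phi> ! i =
    (if i = j then 1 else 0) - (if i \<in> block (comp j) then 1 / of_nat (card (block (comp j))) else 0)"
  using gram[of i j] by (auto simp: block_def)

text \<open>Splits a partial row of the cross Gram matrix into its identity part and its averaging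
  part. Only \<open>I \<inter> block (comp j)\<close> contributes to the average, while the divisor
  stays the full block size; this mismatch later produces the eigenvalues of erasures.\<close>

lemma sum_gram_left:
  assumes "j < n" and I: "I \<subseteq> {..<n}"
  shows "(\<Sum>i\<in>I. (\<Theta> ! j \<bullet>c \<Phi> ! i) * x i) = (if j \<in> I then x j else 0)
    - (\<Sum>i\<in>I \<inter> block (comp j). x i) / of_nat (card (block (comp j)))"
proof -
  have fin: "finite I" using finite_subset[OF I] by simp
  have "(\<Sum>i\<in>I. (\<Theta> ! j \<bullet>c \<Phi> ! i) * x i) = (\<Sum>i\<in>I. (if i = j then x i else 0)
     - (if i \<in> block (comp j) then x i / of_nat (card (block (comp j))) else 0))"
    using assms by (intro sum.cong refl) (auto simp: gram_block left_diff_distrib subset_iff)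
  also have "\<dots> = (if j \<in> I then x j else 0)
     - (\<Sum>i\<in>I. if i \<in> block (comp j) then x i / of_nat (card (block (comp j))) else 0)"
    using fin by (simp add: sum_subtractf)
  also have "(\<Sum>i\<in>I. if i \<in> block (comp j) then x i / of_nat (card (block (comp j))) else 0)
     = (\<Sum>i\<in>I \<inter> block (comp j). x i) / of_nat (card (block (comp j)))"
    using fin by (auto simp: sum.inter_restrict sum_divide_distrib intro!: sum.cong)
  finally show ?thesis .
qed

lemma gram_sym: "i < n \<Longrightarrow> j < n \<Longrightarrow> \<Theta> ! j \<bullet>c \<Phi> ! i = \<Theta> ! i \<bullet>c \<Phi> ! j"
  using gram[of i j] gram[of j i] by auto

lemma gram_cnj: "i < n \<Longrightarrow> j < n \<Longrightarrow> \<Phi> ! i \<bullet>c \<Theta> ! j = \<Theta> ! j \<bullet>c \<Phi> ! i"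
proof -
  assume ij: "i < n" "j < n"
  have "\<Phi> ! i \<bullet>c \<Theta> ! j = cnj (\<Theta> ! j \<bullet>c \<Phi> ! i)"
    unfolding cscalar_sum[OF Phi_carrier[OF ij(1)]] cscalar_sum[OF Theta_carrier[OF ij(2)]]
    by (simp add: mult.commute)
  also have "\<dots> = \<Theta> ! j \<bullet>c \<Phi> ! i" using gram[OF ij] by auto
  finally show ?thesis .
qed

text \<open>Averaging over blocks fixes the indicator of a block, so the complementary projection
  annihilates it.\<close>

lemma sum_gram_block:
  assumes "j < n"
  shows "(\<Sum>i\<in>block c. \<Theta> ! j \<bullet>c \<Phi> ! i) = 0"
proof -
  have sub: "block c \<subseteq> {..<n}" by (auto simp: block_def)
  show ?thesis
  proof (cases "c = comp j")
    case True
    then have "j \<in> block c" using assms by (simp add: block_def)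
    then show ?thesis
      using sum_gram_left[OF assms sub, of "\<lambda>_. 1"] card_block_pos[OF assms] True by auto
  next
    case False
    then have "j \<notin> block c" "block c \<inter> block (comp j) = {}" by (auto simp: block_def)
    then show ?thesis
      using sum_gram_left[OF assms sub, of "\<lambda>_. 1"] by simp
  qed
qed

text \<open>Expanding each \<open>\<Phi> ! l\<close> in \<open>\<Phi>\<close> with the coefficients
  given by \<open>\<Theta>\<close> makes the coefficient of \<open>\<Phi> ! i\<close> in the block
  sum a block sum of the Gram matrix, hence zero.\<close>

lemma sum_Phi_block:
  assumes "p < m"
  shows "(\<Sum>l\<in>block c. \<Phi> ! l $ p) = 0"
proof -
  have bi': "biorthogonal m \<Theta> \<Phi>" using biorthogonal_sym[OF bi] len by simp
  have "(\<Sum>l\<in>block c. \<Phi> ! l $ p) = (\<Sum>l\<in>block c. \<Sum>i<n. (\<Phi> ! l \<bullet>c \<Theta> ! i) * \<Phi> ! i $ p)"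
    using biorthogonal_reconstruct[OF bi' car(2) assms] len by simp
  also have "\<dots> = (\<Sum>i<n. \<Sum>l\<in>block c. (\<Phi> ! l \<bullet>c \<Theta> ! i) * \<Phi> ! i $ p)"
    by (rule sum.swap)
  also have "\<dots> = (\<Sum>i<n. (\<Sum>l\<in>block c. \<Theta> ! i \<bullet>c \<Phi> ! l) * \<Phi> ! i $ p)"
    unfolding sum_distrib_right by (intro sum.cong refl) (simp add: gram_cnj block_less)
  also have "\<dots> = 0" by (simp add: sum_gram_block)
  finally show ?thesis .
qed

text \<open>Reconstruct \<open>\<Theta> ! j\<close> with the dual \<open>y\<close>: the Gram row
  turns the expansion into \<open>y ! j\<close> minus its block average. The difference from
  \<open>\<Theta>\<close> therefore depends only on the block.\<close>

lemma dual_eq_Theta_plus_average: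
  assumes y: "length y = n" "set y \<subseteq> carrier_vec m" "biorthogonal m \<Phi> y" and j: "j < n" and p: "p < m"
  shows "y ! j $ p = \<Theta> ! j $ p + (\<Sum>i\<in>block (comp j). y ! i $ p) / of_nat (card (block (comp j)))"
proof -
  have "{..<n} \<inter> block (comp j) = block (comp j)" by (auto simp: block_def)
  then show ?thesis
    using biorthogonal_reconstruct[OF y(3) car(1) p, of "\<Theta> ! j"]
      sum_gram_left[OF j, of "{..<n}" "\<lambda>i. y ! i $ p"] len j by (simp add: diff_eq_eq)
qed

section \<open>Lower bounds for every dual, and upper bounds for perturbations of
  \<open>\<Theta>\<close>\<close>

lemma erasure_radius_1_ge:
  assumes y: "length y = n" "set y \<subseteq> carrier_vec m" "biorthogonal m \<Phi> y" and k: "k < n"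
  shows "1 - 1 / real (card (block (comp k))) \<le> erasure_radius m 1 \<Phi> y"
proof -
  let ?C = "block (comp k)" and ?N = "card (block (comp k))"
  define w where "w = (\<lambda>p. (\<Sum>i\<in>?C. y ! i $ p) / of_nat ?N)"
  have N: "0 < ?N" using card_block_pos[OF k] .
  then have ne: "?C \<noteq> {}" by auto
  have diag: "y ! j \<bullet>c \<Phi> ! j = \<Theta> ! j \<bullet>c \<Phi> ! j + (\<Sum>p<m. w p * cnj (\<Phi> ! j $ p))" if "j \<in> ?C" for j
  proof -
    have j: "j < n" "comp j = comp k" using that by (auto simp: block_def)
    have "y ! j \<bullet>c \<Phi> ! j = (\<Sum>p<m. (\<Theta> ! j $ p + w p) * cnj (\<Phi> ! j $ p))"
      unfolding cscalar_sum[OF Phi_carrier[OF j(1)]]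
      by (intro sum.cong refl) (simp add: dual_eq_Theta_plus_average[OF y j(1)] w_def j(2))
    then show ?thesis
      unfolding cscalar_sum[OF Phi_carrier[OF j(1)]] by (simp add: distrib_right sum.distrib)
  qed
  \<comment> \<open>The correction \<open>w\<close> is the same throughout the block, so its total
    contribution to the diagonal pairs \<open>w\<close> with the sum of the frame vectors of the
    block, which is zero.\<close>
  have "(\<Sum>j\<in>?C. \<Sum>p<m. w p * cnj (\<Phi> ! j $ p)) = (\<Sum>p<m. w p * cnj (\<Sum>j\<in>?C. \<Phi> ! j $ p))"
    by (subst sum.swap) (simp add: sum_distrib_left)
  also have "\<dots> = 0" by (simp add: sum_Phi_block)
  finally have "(\<Sum>j\<in>?C. y ! j \<bullet>c \<Phi> ! j) = (\<Sum>j\<in>?C. \<Theta> ! j \<bullet>c \<Phi> ! j)"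
    by (simp add: diag sum.distrib)
  also have "\<dots> = (\<Sum>j\<in>?C. 1 - 1 / of_nat ?N)"
    by (intro sum.cong refl) (auto simp: gram_block block_def)
  also have "\<dots> = of_real (real ?N - 1)" using N by (auto simp: right_diff_distrib)
  finally have "cmod (\<Sum>j\<in>?C. y ! j \<bullet>c \<Phi> ! j) = real ?N - 1"
    using N by (simp only: norm_of_real)
  moreover have "cmod (\<Sum>j\<in>?C. y ! j \<bullet>c \<Phi> ! j) \<le> (\<Sum>j\<in>?C. erasure_radius m 1 \<Phi> y)"
  proof (rule sum_norm_le)
    fix j assume "j \<in> ?C"
    then have j: "j < n" by (simp add: block_less)
    have "cmod (y ! j \<bullet>c \<Phi> ! j) \<le> spectral_radius (op_mat m (error_op m \<Phi> y {j}))"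
      using y len car m_pos j by (intro spectral_radius_single_ge) auto
    also have "\<dots> \<le> erasure_radius m 1 \<Phi> y"
      using j len by (intro erasure_radius_geI) auto
    finally show "cmod (y ! j \<bullet>c \<Phi> ! j) \<le> erasure_radius m 1 \<Phi> y" .
  qed
  \<comment> \<open>The \<open>?N\<close> diagonal entries of the block sum to
    \<open>?N - 1\<close>, and each is bounded by the radius.\<close>
  ultimately have "(real ?N - 1) / real ?N \<le> erasure_radius m 1 \<Phi> y"
    using N by (simp add: pos_divide_le_eq mult.commute)
  then show ?thesis using ne by (simp add: diff_divide_distrib)
qed

text \<open>Within a block the corrections of \<open>y ! i\<close> and \<open>y ! j\<close> cancel,
  so their difference has coefficient 1 at \<open>i\<close>, -1 at \<open>j\<close> and 0 elsewhere.
  An error operator that retains both indices reproduces this vector.\<close>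

lemma erasure_radius_ge_1:
  assumes y: "length y = n" "set y \<subseteq> carrier_vec m" "biorthogonal m \<Phi> y"
    and ij: "i < n" "j < n" "i \<noteq> j" "comp i = comp j" and r: "1 < r" "r \<le> n"
  shows "1 \<le> erasure_radius m r \<Phi> y"
proof -
  obtain \<Lambda> where L: "{i, j} \<subseteq> \<Lambda>" "\<Lambda> \<subseteq> {..<n}" "card \<Lambda> = r"
    using exists_subset_between[of "{i, j}" r "{..<n}"] ij r by auto
  define v where "v = vec m (\<lambda>p. y ! i $ p - y ! j $ p)"
  have vp: "v $ p = \<Theta> ! i $ p - \<Theta> ! j $ p" if "p < m" for p
    using that dual_eq_Theta_plus_average[OF y ij(1) that] dual_eq_Theta_plus_average[OF y ij(2) that] ij(4)
    by (simp add: v_def)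
  have vc: "v \<bullet>c \<Phi> ! l = (if l = i then 1 else 0) - (if l = j then 1 else 0)" if l: "l < n" for l
  proof -
    have "v \<bullet>c \<Phi> ! l = \<Theta> ! i \<bullet>c \<Phi> ! l - \<Theta> ! j \<bullet>c \<Phi> ! l"
      unfolding cscalar_sum[OF Phi_carrier[OF l]] by (simp add: vp left_diff_distrib sum_subtractf)
    then show ?thesis using gram[OF l ij(1)] gram[OF l ij(2)] ij(4) by simp
  qed
  have fin: "finite \<Lambda>" using L(2) finite_subset by blast
  have "v \<noteq> 0\<^sub>v m"
  proof
    assume "v = 0\<^sub>v m"
    then have "v \<bullet>c \<Phi> ! i = 0" unfolding cscalar_sum[OF Phi_carrier[OF ij(1)]] by simp
    then show False using vc[OF ij(1)] ij(3) by simp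
  qed
  moreover have "(\<Sum>l\<in>\<Lambda>. (v \<bullet>c \<Phi> ! l) * y ! l $ p) = 1 * v $ p" if "p < m" for p
  proof -
    have "(\<Sum>l\<in>\<Lambda>. (v \<bullet>c \<Phi> ! l) * y ! l $ p)
      = (\<Sum>l\<in>\<Lambda>. (if l = i then y ! l $ p else 0) - (if l = j then y ! l $ p else 0))"
      using L(2) by (intro sum.cong refl) (auto simp: vc subset_iff)
    then show ?thesis using fin L(1) that by (simp add: sum_subtractf v_def)
  qed
  ultimately have "eigenvalue (op_mat m (error_op m \<Phi> y \<Lambda>)) 1"
    using y car len L(2) by (subst eigenvalue_error_op_iff) (auto intro!: bexI[of _ v] simp: v_def)
  then have "cmod 1 \<le> spectral_radius (op_mat m (error_op m \<Phi> y \<Lambda>))"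
    using m_pos by (intro spectral_radius_geI[where m = m]) (auto simp: op_mat_def)
  also have "\<dots> \<le> erasure_radius m r \<Phi> y"
    using L len by (intro erasure_radius_geI) auto
  finally show ?thesis by simp
qed

text \<open>Since \<open>\<beta>\<close> vanishes on block \<open>a\<close>, the perturbation leaves
  the diagonal blocks of the Gram matrix intact and makes it block triangular. The sums of an
  eigenvector's coefficients over the erased part of each block then obey scalar equations that
  locate the eigenvalue.\<close>

lemma spectral_radius_perturbed_le_1:
  assumes \<Psi>: "length \<Psi> = n" "set \<Psi> \<subseteq> carrier_vec m"
    and pert: "\<And>i l. i < n \<Longrightarrow> l < n \<Longrightarrow>
      \<Psi> ! i \<bullet>c \<Phi> ! l = \<Theta> ! i \<bullet>c \<Phi> ! l + (if comp i = a then \<beta> l else 0)"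
    and \<beta>: "\<And>l. l < n \<Longrightarrow> comp l = a \<Longrightarrow> \<beta> l = 0"
    and L: "\<Lambda> \<subseteq> {..<n}"
  shows "spectral_radius (op_mat m (error_op m \<Phi> \<Psi> \<Lambda>)) \<le> 1"
proof (rule spectral_radius_leI)
  fix \<mu> assume ev: "eigenvalue (op_mat m (error_op m \<Phi> \<Psi> \<Lambda>)) \<mu>"
  show "cmod \<mu> \<le> 1"
  proof (cases "\<mu> = 0")
    case False
    have fin: "finite \<Lambda>" using L finite_subset by blast
    have lenP: "length \<Psi> = length \<Phi>" and L': "\<Lambda> \<subseteq> {..<length \<Phi>}" using \<Psi> len L by auto
    obtain c where nz: "\<exists>l\<in>\<Lambda>. c l \<noteq> 0"
      and c0: "\<And>l. l < n \<Longrightarrow> \<mu> * c l = (\<Sum>i\<in>\<Lambda>. c i * (\<Psi> ! i \<bullet>c \<Phi> ! l))"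
      using eigenvalue_error_op_coeffs[OF lenP car(1) \<Psi>(2) L' ev False] len by metis
    define T where "T b = (\<Sum>i\<in>\<Lambda> \<inter> block b. c i)" for b
    have c: "\<mu> * c l = c l - T (comp l) / of_nat (card (block (comp l))) + \<beta> l * T a"
      if l: "l \<in> \<Lambda>" for l
    proof -
      have ln: "l < n" using l L by auto
      have "\<mu> * c l = (\<Sum>i\<in>\<Lambda>. (\<Theta> ! l \<bullet>c \<Phi> ! i) * c i + (if i \<in> block a then \<beta> l * c i else 0))"
        unfolding c0[OF ln] using L ln
        by (intro sum.cong refl) (auto simp: pert gram_sym[of l] block_def algebra_simps)
      also have "\<dots> = (\<Sum>i\<in>\<Lambda>. (\<Theta> ! l \<bullet>c \<Phi> ! i) * c i) + \<beta> l * T a"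
        unfolding T_def sum.inter_restrict[OF fin] sum_distrib_left sum.distrib[symmetric]
        by (intro sum.cong refl) simp
      finally show ?thesis using l by (simp add: sum_gram_left[OF ln L] T_def)
    qed
    \<comment> \<open>Sum the coefficient equation over the erased indices of block
      \<open>b\<close>. The perturbation term drops out because \<open>\<beta>\<close> vanishes on
      block \<open>a\<close>, or because \<open>T a = 0\<close>.\<close>
    have key: "\<mu> * T b = (1 - of_nat (card (\<Lambda> \<inter> block b)) / of_nat (card (block b))) * T b"
      if "b = a \<or> T a = 0" for b
    proof -
      have "\<mu> * T b = (\<Sum>l\<in>\<Lambda> \<inter> block b. c l - T b / of_nat (card (block b)))"
        unfolding T_def[of b] sum_distrib_left
      proof (intro sum.cong refl)
        fix l assume l: "l \<in> \<Lambda> \<inter> block b"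
        then have l': "l \<in> \<Lambda>" "comp l = b" "l < n" by (auto simp: block_def)
        have "\<beta> l * T a = 0" using that \<beta>[of l] l' by auto
        then show "\<mu> * c l = c l - (\<Sum>i\<in>\<Lambda> \<inter> block b. c i) / of_nat (card (block b))"
          using c[OF l'(1)] by (simp only: l'(2) add_0_right T_def[of b])
      qed
      also have "\<dots> = T b - of_nat (card (\<Lambda> \<inter> block b)) * (T b / of_nat (card (block b)))"
        by (simp add: sum_subtractf T_def)
      finally show ?thesis by (simp add: algebra_simps)
    qed
    have bound: "cmod \<mu> \<le> 1" if "b = a \<or> T a = 0" "T b \<noteq> 0" for b
    proof -
      let ?x = "real (card (\<Lambda> \<inter> block b)) / real (card (block b))"
      have "\<mu> = 1 - of_nat (card (\<Lambda> \<inter> block b)) / of_nat (card (block b))"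
        using key[OF that(1)] that(2) by simp
      then have "\<mu> = of_real (1 - ?x)" by simp
      then have "cmod \<mu> = \<bar>1 - ?x\<bar>" by (simp only: norm_of_real)
      moreover have "0 \<le> ?x" "?x \<le> 1"
        using card_mono[of "block b" "\<Lambda> \<inter> block b"] by (auto simp: divide_le_eq_1)
      ultimately show ?thesis by simp
    qed
    \<comment> \<open>If \<open>T a\<close> is nonzero, block \<open>a\<close> decides; if
      \<open>T a = 0\<close>, any block with nonzero sum does. If all block sums vanish, the
      coefficient equation reads \<open>\<mu> * c l = c l\<close>, so the eigenvalue is 1.\<close>
    show ?thesis
    proof (cases "\<exists>b. T b \<noteq> 0")
      case True
      then show ?thesis using bound by (cases "T a = 0") auto
    next
      case F: False
      obtain l where "l \<in> \<Lambda>" "c l \<noteq> 0" using nz by blast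
      then show ?thesis using c[of l] F by simp
    qed
  qed simp
qed (use m_pos in \<open>auto simp: op_mat_def\<close>)

text \<open>Single erasures only see the diagonal of the Gram matrix, which is that of
  \<open>\<Theta>\<close>. \<open>X\<close> will be the radius of a competing dual, which
  \<open>erasure_radius_1_ge\<close> bounds from below on every block.\<close>

lemma erasure_radius_1_perturbed_le:
  assumes \<Psi>: "length \<Psi> = n" "set \<Psi> \<subseteq> carrier_vec m"
    and diag: "\<And>i. i < n \<Longrightarrow> \<Psi> ! i \<bullet>c \<Phi> ! i = \<Theta> ! i \<bullet>c \<Phi> ! i"
    and X: "\<And>i. i < n \<Longrightarrow> 1 - 1 / real (card (block (comp i))) \<le> X" and n: "1 \<le> n"
  shows "erasure_radius m 1 \<Phi> \<Psi> \<le> X"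
proof (rule erasure_radius_leI)
  fix \<Lambda> :: "nat set" assume "\<Lambda> \<subseteq> {..<length \<Phi>}" "card \<Lambda> = 1"
  then obtain j where j: "\<Lambda> = {j}" "j < n" using len by (auto simp: card_1_singleton_iff)
  have "\<Theta> ! j \<bullet>c \<Phi> ! j = of_real (1 - 1 / real (card (block (comp j))))"
    using j(2) by (simp add: gram_block block_def)
  then have "cmod (\<Theta> ! j \<bullet>c \<Phi> ! j) = \<bar>1 - 1 / real (card (block (comp j)))\<bar>"
    by (simp only: norm_of_real)
  also have "\<dots> = 1 - 1 / real (card (block (comp j)))"
    using card_block_pos[OF j(2)] by (simp add: divide_le_eq_1)
  finally have "cmod (\<Psi> ! j \<bullet>c \<Phi> ! j) \<le> X" using X[OF j(2)] diag[OF j(2)] by simp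
  moreover have "spectral_radius (op_mat m (error_op m \<Phi> \<Psi> {j})) \<le> cmod (\<Psi> ! j \<bullet>c \<Phi> ! j)"
    using \<Psi> len car m_pos j by (intro spectral_radius_single_le) auto
  ultimately show "spectral_radius (op_mat m (error_op m \<Phi> \<Psi> \<Lambda>)) \<le> X" using j by simp
qed (use n len in simp)

section \<open>Optimality of perturbations and non-uniqueness\<close>

lemma perturbed_SOD_frame:
  assumes \<Psi>: "length \<Psi> = n" "set \<Psi> \<subseteq> carrier_vec m" "biorthogonal m \<Phi> \<Psi>"
    and pert: "\<And>i l. i < n \<Longrightarrow> l < n \<Longrightarrow>
      \<Psi> ! i \<bullet>c \<Phi> ! l = \<Theta> ! i \<bullet>c \<Phi> ! l + (if comp i = a then \<beta> l else 0)"
    and \<beta>: "\<And>l. l < n \<Longrightarrow> comp l = a \<Longrightarrow> \<beta> l = 0"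
    and ij: "i < n" "j < n" "i \<noteq> j" "comp i = comp j" and r: "1 \<le> r" "r < n"
  shows "SOD_frame m \<Phi> r \<Psi>"
proof -
  note iff = dual_frames_iff[OF car(1), unfolded len]
  have dual: "\<Psi> \<in> dual_frames m \<Phi>" using \<Psi> iff by blast
  \<comment> \<open>The diagonal is unperturbed: where the perturbation acts, on block
    \<open>a\<close>, \<open>\<beta>\<close> is zero.\<close>
  have one: "is_arg_min (erasure_radius m 1 \<Phi>) (\<lambda>\<Psi>'. \<Psi>' \<in> dual_frames m \<Phi>) \<Psi>"
    unfolding is_arg_min_linorder
  proof (intro conjI allI impI dual)
    fix y assume "y \<in> dual_frames m \<Phi>"
    then show "erasure_radius m 1 \<Phi> \<Psi> \<le> erasure_radius m 1 \<Phi> y"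
      using iff erasure_radius_1_ge pert \<beta> \<Psi> r by (intro erasure_radius_1_perturbed_le) auto
  qed
  \<comment> \<open>For more than one erasure, the pair \<open>i\<close>, \<open>j\<close> forces
    radius at least 1 on every dual, and \<open>\<Psi>\<close> stays within 1.\<close>
  have more: "is_arg_min (erasure_radius m s \<Phi>) (\<lambda>\<Psi>'. \<Psi>' \<in> dual_frames m \<Phi>) \<Psi>"
    if "1 < s" "s < n" for s
    unfolding is_arg_min_linorder
  proof (intro conjI allI impI dual)
    fix y assume "y \<in> dual_frames m \<Phi>"
    then have "1 \<le> erasure_radius m s \<Phi> y"
      using iff that by (intro erasure_radius_ge_1[OF _ _ _ ij]) auto
    moreover have "erasure_radius m s \<Phi> \<Psi> \<le> 1"
      using that len by (intro erasure_radius_leI spectral_radius_perturbed_le_1[OF \<Psi>(1,2) pert \<beta>]) auto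
    ultimately show "erasure_radius m s \<Phi> \<Psi> \<le> erasure_radius m s \<Phi> y" by simp
  qed
  show ?thesis using r(1)
  proof (induction r rule: dec_induct)
    case base
    show ?case using one len r by - (rule SOD_frame.one, simp_all)
  next
    case (step s)
    have "1 < Suc s" "Suc s < n" using step.hyps r by simp_all
    then show ?case using more[of "Suc s"] step len by - (rule SOD_frame.step, simp_all)
  qed
qed

lemma Theta_SOD_frame:
  assumes "i < n" "j < n" "i \<noteq> j" "comp i = comp j" "1 \<le> r" "r < n"
  shows "SOD_frame m \<Phi> r \<Theta>"
  \<comment> \<open>With the zero perturbation the label \<open>a\<close> may be anything.\<close>
  by (rule perturbed_SOD_frame[OF len(2) car(2) bi, where \<beta> = "\<lambda>_. 0" and i = i and j = j])
    (use assms in simp_all)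

text \<open>Adding \<open>\<Theta> ! i\<close> to the vectors of a component not containing \<open>i\<close> keeps
  duality, since the frame vectors of a component sum to zero, and it makes the cross Gram matrix block
  triangular without changing its diagonal blocks.\<close>

lemma ex_other_SOD_frame:
  assumes ij: "i < n" "j < n" "i \<noteq> j" "comp i = comp j" and k: "k < n" "comp k \<noteq> comp i"
    and r: "1 \<le> r" "r < n"
  shows "\<exists>\<Psi>\<in>dual_frames m \<Phi>. \<Psi> \<noteq> \<Theta> \<and> SOD_frame m \<Phi> r \<Psi>"
proof -
  define \<Psi> where "\<Psi> = map (\<lambda>l. if comp l = comp k then \<Theta> ! l + \<Theta> ! i else \<Theta> ! l) [0..<n]"
  have nth: "\<Psi> ! l = (if comp l = comp k then \<Theta> ! l + \<Theta> ! i else \<Theta> ! l)" if "l < n" for l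
    using that by (simp add: \<Psi>_def)
  have idx: "\<Psi> ! l $ p = \<Theta> ! l $ p + (if comp l = comp k then \<Theta> ! i $ p else 0)" if "l < n" "p < m" for l p
    using that carrier_vecD[OF Theta_carrier[OF ij(1)]] by (simp add: nth)
  have lenP: "length \<Psi> = n" by (simp add: \<Psi>_def)
  have carP: "set \<Psi> \<subseteq> carrier_vec m"
    using Theta_carrier ij(1) by (auto simp: \<Psi>_def)
  have biP: "biorthogonal m \<Phi> \<Psi>"
    unfolding biorthogonal_def
  proof (intro allI impI)
    fix p q assume pq: "p < m" "q < m"
    have "(\<Sum>l<n. cnj (\<Phi> ! l $ q) * \<Psi> ! l $ p)
      = (\<Sum>l<n. cnj (\<Phi> ! l $ q) * \<Theta> ! l $ p + (if l \<in> block (comp k) then cnj (\<Phi> ! l $ q) * \<Theta> ! i $ p else 0))"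
      using pq by (intro sum.cong refl) (auto simp: idx block_def distrib_left)
    also have "\<dots> = (\<Sum>l<n. cnj (\<Phi> ! l $ q) * \<Theta> ! l $ p) + (\<Sum>l\<in>{..<n} \<inter> block (comp k). cnj (\<Phi> ! l $ q) * \<Theta> ! i $ p)"
      by (simp add: sum.distrib sum.inter_restrict)
    also have "{..<n} \<inter> block (comp k) = block (comp k)" by (auto simp: block_def)
    also have "(\<Sum>l\<in>block (comp k). cnj (\<Phi> ! l $ q) * \<Theta> ! i $ p) = cnj (\<Sum>l\<in>block (comp k). \<Phi> ! l $ q) * \<Theta> ! i $ p"
      by (simp add: sum_distrib_right)
    also have "\<dots> = 0" using pq by (simp add: sum_Phi_block)
    also have "(\<Sum>l<n. cnj (\<Phi> ! l $ q) * \<Theta> ! l $ p) = (if p = q then 1 else 0)"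
      using bi pq len unfolding biorthogonal_def by blast
    finally show "(\<Sum>l<length \<Phi>. cnj (\<Phi> ! l $ q) * \<Psi> ! l $ p) = (if p = q then 1 else 0)"
      using len by simp
  qed
  have pert: "\<Psi> ! s \<bullet>c \<Phi> ! l = \<Theta> ! s \<bullet>c \<Phi> ! l + (if comp s = comp k then \<Theta> ! i \<bullet>c \<Phi> ! l else 0)"
    if "s < n" "l < n" for s l
    unfolding cscalar_sum[OF Phi_carrier[OF that(2)]]
    using that by (auto simp: idx distrib_right sum.distrib)
  have \<beta>: "\<Theta> ! i \<bullet>c \<Phi> ! l = 0" if "l < n" "comp l = comp k" for l
    using gram[OF that(1) ij(1)] that(2) k(2) by auto
  \<comment> \<open>Equality at index \<open>k\<close> would force \<open>\<Theta> ! i\<close> to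
    pair to zero with \<open>\<Phi> ! i\<close>, so the block of \<open>i\<close> would have size 1,
    although it also contains \<open>j\<close>.\<close>
  have "\<Psi> \<noteq> \<Theta>"
  proof
    assume "\<Psi> = \<Theta>"
    then have "\<Theta> ! i \<bullet>c \<Phi> ! i = 0" using pert[OF k(1) ij(1)] by simp
    then have "1 / of_nat (card (block (comp i))) = (1 :: complex)"
      using gram_block[OF ij(1) ij(1)] ij(1) by (auto simp: block_def)
    then have "card (block (comp i)) = 1" by (auto simp: field_simps)
    moreover have "{i, j} \<subseteq> block (comp i)" using ij by (auto simp: block_def)
    ultimately show False using ij(3) card_mono[of "block (comp i)" "{i, j}"] by simp
  qed
  moreover have "SOD_frame m \<Phi> r \<Psi>"
    by (rule perturbed_SOD_frame[OF lenP carP biP pert \<beta> ij r])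
  moreover have "\<Psi> \<in> dual_frames m \<Phi>"
    by (simp add: dual_frames_iff[OF car(1)] lenP carP biP len)
  ultimately show ?thesis by blast
qed

text \<open>The frame operator maps \<open>\<Theta> ! j\<close> to \<open>\<Phi> ! j\<close>;
  injectivity on the carrier then lets \<open>inv_into\<close> return exactly
  \<open>\<Theta> ! j\<close>.\<close>

lemma canonical_dual_eq: "canonical_dual m \<Phi> = \<Theta>"
proof -
  let ?S = "frame_op m \<Phi>"
  have S_car: "?S f \<in> carrier_vec m" for f
    unfolding frame_op_def using car by (intro finsum_vec_frame_closed) auto
  have S_idx: "?S f $ p = (\<Sum>i<n. (f \<bullet>c \<Phi> ! i) * \<Phi> ! i $ p)" if "p < m" for f p
    unfolding frame_op_def using car len that by (subst finsum_vec_frame_index) auto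
  have S_Theta: "?S (\<Theta> ! j) = \<Phi> ! j" if j: "j < n" for j
  proof (rule eq_vecI)
    fix p assume "p < dim_vec (\<Phi> ! j)"
    then have p: "p < m" using carrier_vecD[OF Phi_carrier[OF j]] by simp
    have "{..<n} \<inter> block (comp j) = block (comp j)" by (auto simp: block_def)
    then show "?S (\<Theta> ! j) $ p = \<Phi> ! j $ p"
      using sum_gram_left[OF j, of "{..<n}" "\<lambda>i. \<Phi> ! i $ p"] p j by (simp add: S_idx sum_Phi_block)
  qed (use carrier_vecD[OF S_car] carrier_vecD[OF Phi_carrier[OF j]] in simp)
  \<comment> \<open>Self-adjointness of the frame operator combined with \<open>S_Theta\<close>,
    carried out in coordinates.\<close>
  have coeff: "?S f \<bullet>c \<Theta> ! j = f \<bullet>c \<Phi> ! j" if j: "j < n" for f j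
  proof -
    have "?S f \<bullet>c \<Theta> ! j = (\<Sum>p<m. (\<Sum>i<n. (f \<bullet>c \<Phi> ! i) * \<Phi> ! i $ p) * cnj (\<Theta> ! j $ p))"
      unfolding cscalar_sum[OF Theta_carrier[OF j]] by (simp add: S_idx)
    also have "\<dots> = (\<Sum>p<m. \<Sum>i<n. (f \<bullet>c \<Phi> ! i) * (\<Phi> ! i $ p * cnj (\<Theta> ! j $ p)))"
      by (simp add: sum_distrib_right mult.assoc)
    also have "\<dots> = (\<Sum>i<n. (f \<bullet>c \<Phi> ! i) * (\<Phi> ! i \<bullet>c \<Theta> ! j))"
      unfolding cscalar_sum[OF Theta_carrier[OF j]] by (subst sum.swap) (simp add: sum_distrib_left)
    also have "\<dots> = (\<Sum>i<n. (f \<bullet>c \<Phi> ! i) * (\<Theta> ! j \<bullet>c \<Phi> ! i))"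
      using j by (intro sum.cong refl) (simp add: gram_cnj)
    also have "\<dots> = (\<Sum>q<m. f $ q * (\<Sum>i<n. cnj (\<Phi> ! i $ q) * (\<Theta> ! j \<bullet>c \<Phi> ! i)))"
      using Phi_carrier by (intro sum_cscalar_swap) auto
    also have "\<dots> = (\<Sum>q<m. f $ q * cnj (\<Phi> ! j $ q))"
    proof (intro sum.cong refl)
      fix q assume "q \<in> {..<m}"
      then have q: "q < m" by simp
      have "{..<n} \<inter> block (comp j) = block (comp j)" by (auto simp: block_def)
      then have "(\<Sum>i<n. (\<Theta> ! j \<bullet>c \<Phi> ! i) * cnj (\<Phi> ! i $ q))
          = cnj (\<Phi> ! j $ q) - cnj (\<Sum>i\<in>block (comp j). \<Phi> ! i $ q) / of_nat (card (block (comp j)))"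
        using sum_gram_left[OF j, of "{..<n}" "\<lambda>i. cnj (\<Phi> ! i $ q)"] j by simp
      then show "f $ q * (\<Sum>i<n. cnj (\<Phi> ! i $ q) * (\<Theta> ! j \<bullet>c \<Phi> ! i)) = f $ q * cnj (\<Phi> ! j $ q)"
        using q by (simp add: sum_Phi_block mult.commute)
    qed
    finally show ?thesis unfolding cscalar_sum[OF Phi_carrier[OF j]] .
  qed
  \<comment> \<open>By \<open>coeff\<close>, the image of \<open>f\<close> determines all its frame
    coefficients, and these reconstruct \<open>f\<close>.\<close>
  have inj: "inj_on ?S (carrier_vec m)"
  proof (rule inj_onI)
    fix f g assume fg: "f \<in> carrier_vec m" "g \<in> carrier_vec m" "?S f = ?S g"
    have "f \<bullet>c \<Phi> ! i = g \<bullet>c \<Phi> ! i" if "i < n" for i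
      using coeff[OF that, of f] coeff[OF that, of g] fg(3) by simp
    then have "f $ p = g $ p" if "p < m" for p
      using biorthogonal_reconstruct[OF bi car(1) that, of f]
        biorthogonal_reconstruct[OF bi car(1) that, of g] len by simp
    then show "f = g" using carrier_vecD[OF fg(1)] carrier_vecD[OF fg(2)] by (intro eq_vecI) simp_all
  qed
  have "inv_into (carrier_vec m) ?S (\<Phi> ! j) = \<Theta> ! j" if "j < n" for j
    using inv_into_f_f[OF inj Theta_carrier[OF that]] S_Theta[OF that] by simp
  then show ?thesis
    unfolding canonical_dual_def using len by (intro nth_equalityI) simp_all
qed

end

section \<open>The Laplacian\<close>

text \<open>The quadratic form of the Laplacian is half the weighted sum of the \<open>\<bar>x i - x j\<bar>\<^sup>2\<close>.\<close>

lemma laplacian_kernel_edge: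
  fixes a :: "nat \<Rightarrow> nat \<Rightarrow> real" and x :: "nat \<Rightarrow> complex"
  assumes nonneg: "\<And>i j. 0 \<le> a i j" and sym: "\<And>i j. a i j = a j i"
    and ker: "\<And>i. i < n \<Longrightarrow> (\<Sum>j<n. of_real (a i j) * (x i - x j)) = 0"
    and ij: "i < n" "j < n" "a i j \<noteq> 0"
  shows "x i = x j"
proof -
  \<comment> \<open>Symmetrising \<open>b\<close> completes the square: \<open>b i j + b j i\<close>
    is \<open>a i j\<close> times the squared modulus of \<open>x i - x j\<close>, while the double
    sum of \<open>b\<close> vanishes by the kernel equation.\<close>
  define b where "b = (\<lambda>i j. of_real (a i j) * (x i - x j) * cnj (x i))"
  have b0: "(\<Sum>i<n. \<Sum>j<n. b i j) = 0"
  proof (rule sum.neutral, rule ballI)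
    fix i assume "i \<in> {..<n}"
    then have "(\<Sum>j<n. of_real (a i j) * (x i - x j)) * cnj (x i) = 0" using ker by simp
    then show "(\<Sum>j<n. b i j) = 0" by (simp only: b_def sum_distrib_right)
  qed
  have "of_real (\<Sum>i<n. \<Sum>j<n. a i j * (cmod (x i - x j))\<^sup>2) = (\<Sum>i<n. \<Sum>j<n. b i j + b j i)"
    unfolding of_real_sum
  proof (intro sum.cong refl)
    fix i j
    have *: "complex_of_real ((cmod (x i - x j))\<^sup>2) = (x i - x j) * cnj (x i - x j)"
      by (rule complex_norm_square)
    show "complex_of_real (a i j * (cmod (x i - x j))\<^sup>2) = b i j + b j i"
      unfolding b_def sym[of j i] of_real_mult * by (simp add: algebra_simps)
  qed
  also have "\<dots> = (\<Sum>i<n. \<Sum>j<n. b i j) + (\<Sum>i<n. \<Sum>j<n. b j i)"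
    by (simp add: sum.distrib)
  also have "(\<Sum>i<n. \<Sum>j<n. b j i) = (\<Sum>i<n. \<Sum>j<n. b i j)" by (rule sum.swap)
  finally have S: "(\<Sum>i<n. \<Sum>j<n. a i j * (cmod (x i - x j))\<^sup>2) = 0"
    using b0 by (simp only: of_real_eq_0_iff add_0)
  have "(\<Sum>j<n. a i j * (cmod (x i - x j))\<^sup>2) = 0"
    using sum_nonneg_0[OF _ _ S, of i] nonneg ij(1) by (simp add: sum_nonneg)
  then have "a i j * (cmod (x i - x j))\<^sup>2 = 0"
    using sum_nonneg_0[of "{..<n}" "\<lambda>j. a i j * (cmod (x i - x j))\<^sup>2" j] nonneg ij(2) by simp
  then show ?thesis using ij(3) by simp
qed

text \<open>\<open>L\<close> has the same kernel as the projection \<open>U U\<^sup>*\<close>, namely the functions constant on the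
  blocks of \<open>comp\<close>; so the complementary projection averages over the blocks.\<close>

lemma projection_gram:
  fixes U L :: "nat \<Rightarrow> nat \<Rightarrow> complex" and ev :: "nat \<Rightarrow> complex" and comp :: "nat \<Rightarrow> 'c"
  assumes orth: "\<And>p q. p < m \<Longrightarrow> q < m \<Longrightarrow> (\<Sum>i<n. cnj (U i p) * U i q) = (if p = q then 1 else 0)"
    and L: "\<And>i j. i < n \<Longrightarrow> j < n \<Longrightarrow> L i j = (\<Sum>p<m. U i p * ev p * cnj (U j p))"
    and ev: "\<And>p. p < m \<Longrightarrow> ev p \<noteq> 0"
    and ker: "\<And>x i j. (\<And>i. i < n \<Longrightarrow> (\<Sum>j<n. L i j * x j) = 0) \<Longrightarrow>
      i < n \<Longrightarrow> j < n \<Longrightarrow> comp i = comp j \<Longrightarrow> x i = x j"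
    and ind: "\<And>c i. i < n \<Longrightarrow> (\<Sum>j<n. L i j * (if comp j = c then 1 else 0)) = 0"
    and ij: "i < n" "j < n"
  shows "(\<Sum>p<m. U i p * cnj (U j p)) = (if i = j then 1 else 0)
    - (if comp i = comp j then 1 / of_nat (card {l. l < n \<and> comp l = comp i}) else 0)"
proof -
  define P where "P = (\<lambda>i j. \<Sum>p<m. U i p * cnj (U j p))"
  define Q where "Q = (\<lambda>i j. (if i = j then 1 else 0) - P i j)"
  have Lx: "(\<Sum>j<n. L i j * x j) = (\<Sum>p<m. U i p * ev p * (\<Sum>j<n. cnj (U j p) * x j))"
    if "i < n" for i x
  proof -
    have "(\<Sum>j<n. L i j * x j) = (\<Sum>j<n. \<Sum>p<m. U i p * ev p * (cnj (U j p) * x j))"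
      using that by (intro sum.cong refl) (simp add: L sum_distrib_right mult.assoc)
    then show ?thesis by (subst (asm) sum.swap) (simp add: sum_distrib_left)
  qed
  have P_left: "(\<Sum>j<n. cnj (U j p) * P j l) = cnj (U l p)" if "p < m" for p l
  proof -
    have "(\<Sum>j<n. cnj (U j p) * P j l) = (\<Sum>j<n. \<Sum>q<m. (cnj (U j p) * U j q) * cnj (U l q))"
      by (simp add: P_def sum_distrib_left mult.assoc)
    also have "\<dots> = (\<Sum>q<m. (\<Sum>j<n. cnj (U j p) * U j q) * cnj (U l q))"
      by (subst sum.swap) (simp add: sum_distrib_right)
    also have "\<dots> = (\<Sum>q<m. if q = p then cnj (U l q) else 0)"
      using that by (intro sum.cong refl) (simp add: orth)
    finally show ?thesis using that by simp
  qed
  \<comment> \<open>The columns of the complementary projection \<open>Q\<close> lie in the kernel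
    of \<open>L\<close>, so \<open>Q\<close> is constant on blocks in its first index; being
    Hermitian, also in its second.\<close>
  have LQ: "(\<Sum>j<n. L i j * Q j l) = 0" if "i < n" "l < n" for i l
  proof -
    have "(\<Sum>j<n. cnj (U j p) * Q j l) = 0" if "p < m" for p
    proof -
      have "(\<Sum>j<n. cnj (U j p) * Q j l)
        = (\<Sum>j<n. (if j = l then cnj (U j p) else 0) - cnj (U j p) * P j l)"
        by (intro sum.cong refl) (simp add: Q_def right_diff_distrib)
      then show ?thesis using \<open>l < n\<close> that by (simp add: sum_subtractf P_left)
    qed
    then show ?thesis by (simp add: Lx[OF that(1)])
  qed
  have Q_const: "Q i l = Q j l" if "i < n" "j < n" "comp i = comp j" "l < n" for i j l
    using ker[of "\<lambda>i. Q i l"] LQ that by blast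
  have Q_cnj: "Q j i = cnj (Q i j)" for i j
    by (auto simp: Q_def P_def mult.commute)
  \<comment> \<open>Block indicators lie in the kernel of \<open>L\<close>. Applying the adjoint of
    \<open>U\<close> isolates one term \<open>ev p * ?h p\<close>, and the nonzero
    \<open>ev p\<close> cancels.\<close>
  have PU: "(\<Sum>j<n. cnj (U j p) * (if comp j = c then 1 else 0)) = 0" (is "?h p = 0") if p: "p < m" for p c
  proof -
    have "0 = (\<Sum>i<n. cnj (U i p) * (\<Sum>q<m. U i q * ev q * ?h q))"
      using ind[of _ c] Lx[of _ "\<lambda>j. if comp j = c then 1 else 0"] by simp
    also have "\<dots> = (\<Sum>i<n. \<Sum>q<m. (cnj (U i p) * U i q) * (ev q * ?h q))"
      by (simp only: sum_distrib_left mult.assoc)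
    also have "\<dots> = (\<Sum>q<m. (\<Sum>i<n. cnj (U i p) * U i q) * (ev q * ?h q))"
      by (subst sum.swap) (simp only: sum_distrib_right)
    also have "\<dots> = (\<Sum>q<m. if q = p then ev q * ?h q else 0)"
      using p by (intro sum.cong refl) (simp add: orth)
    also have "\<dots> = ev p * ?h p" using p by simp
    finally show ?thesis using ev[OF p] by simp
  qed
  have P_ind: "(\<Sum>l<n. P i l * (if comp l = c then 1 else 0)) = 0" for i c
  proof -
    have "(\<Sum>l<n. P i l * (if comp l = c then 1 else 0))
      = (\<Sum>l<n. \<Sum>p<m. U i p * (cnj (U l p) * (if comp l = c then 1 else 0)))"
      by (simp only: P_def sum_distrib_right mult.assoc)
    also have "\<dots> = (\<Sum>p<m. U i p * (\<Sum>l<n. cnj (U l p) * (if comp l = c then 1 else 0)))"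
      by (subst sum.swap) (simp only: sum_distrib_left)
    also have "\<dots> = 0" using PU by (intro sum.neutral) auto
    finally show ?thesis .
  qed
  let ?C = "{l. l < n \<and> comp l = comp j}"
  have Cset: "?C = {..<n} \<inter> {l. comp l = comp j}" by auto
  \<comment> \<open>Evaluate the sum of row \<open>i\<close> of \<open>Q\<close> over the block of
    \<open>j\<close> in two ways: by constancy of \<open>Q\<close>, and by \<open>Q\<close> fixing
    the indicator of the block.\<close>
  have "of_nat (card ?C) * Q i j = (\<Sum>l\<in>?C. Q i l)"
  proof -
    have "Q i l = Q i j" if "l \<in> ?C" for l
      using Q_const[of l j i] Q_cnj[of l i] Q_cnj[of j i] that ij by simp
    then show ?thesis by simp
  qed
  also have "\<dots> = (\<Sum>l<n. if comp l = comp j then Q i l else 0)"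
    unfolding Cset by (subst sum.inter_restrict) auto
  also have "\<dots> = (\<Sum>l<n. (if l = i then (if comp l = comp j then 1 else 0) else 0)
      - P i l * (if comp l = comp j then 1 else 0))"
    by (intro sum.cong refl) (auto simp: Q_def)
  also have "\<dots> = (if comp i = comp j then 1 else 0)"
    using ij(1) P_ind[of i "comp j"] by (simp only: sum_subtractf) simp
  finally have "of_nat (card ?C) * Q i j = (if comp i = comp j then 1 else 0)" .
  moreover have "card ?C \<noteq> 0" using ij(2) by auto
  ultimately have "Q i j = (if comp i = comp j then 1 / of_nat (card ?C) else 0)"
    by (auto simp: field_simps)
  then have "P i j = (if i = j then 1 else 0) - (if comp i = comp j then 1 / of_nat (card ?C) else 0)"
    by (simp add: Q_def algebra_simps)
  then show ?thesis unfolding P_def by (cases "comp i = comp j") simp_all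
qed

section \<open>From adjacency to components: the kernel of the graph Laplacian\<close>

lemma out_degree_eq_sum:
  assumes "graph G" "distinct vs" "set vs = verts G"
  shows "(of_nat (out_degree G u) :: 'x :: semiring_1)
    = (\<Sum>j<length vs. if (u, vs ! j) \<in> arcs_ends G then 1 else 0)"
proof -
  interpret graph G by fact
  let ?J = "{j. j < length vs \<and> (u, vs ! j) \<in> arcs_ends G}"
  \<comment> \<open>Without parallel arcs, an arc leaving \<open>u\<close> is determined by its
    head, so counting arcs is counting neighbours.\<close>
  have "inj_on (head G) (out_arcs G u)"
    using no_multi_arcs by (intro inj_onI) (auto simp: out_arcs_def arc_to_ends_def)
  then have "out_degree G u = card (head G ` out_arcs G u)"
    by (simp add: out_degree_def card_image)
  also have "head G ` out_arcs G u = (!) vs ` ?J"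
  proof
    show "head G ` out_arcs G u \<subseteq> (!) vs ` ?J"
    proof
      fix v assume "v \<in> head G ` out_arcs G u"
      then have v: "(u, v) \<in> arcs_ends G" "v \<in> verts G" by (auto simp: out_arcs_def arcs_ends_conv)
      then obtain j where "j < length vs" "vs ! j = v" using assms(3) by (metis in_set_conv_nth)
      then show "v \<in> (!) vs ` ?J" using v by auto
    qed
    show "(!) vs ` ?J \<subseteq> head G ` out_arcs G u" by (auto simp: out_arcs_def arcs_ends_conv)
  qed
  also have "card ((!) vs ` ?J) = card ?J"
    using assms(2) by (intro card_image inj_onI) (auto simp: nth_eq_iff_index_eq)
  finally have "out_degree G u = card ({..<length vs} \<inter> {j. (u, vs ! j) \<in> arcs_ends G})"
    by (simp add: Int_def)
  then show ?thesis by (simp add: sum.If_cases Int_def)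
qed

text \<open>The degree is the row sum of the adjacency matrix, which turns the product into a sum of
  differences, the shape required by \<open>laplacian_kernel_edge\<close>.\<close>

lemma laplacian_mult_index:
  assumes "graph G" "distinct vs" "set vs = verts G" and i: "i < length vs"
  shows "(\<Sum>j<length vs. laplacian G vs $$ (i, j) * x j)
    = (\<Sum>j<length vs. of_real (if (vs ! i, vs ! j) \<in> arcs_ends G then 1 else 0) * (x i - x j))"
proof -
  let ?a = "\<lambda>j. if (vs ! i, vs ! j) \<in> arcs_ends G then 1 else 0 :: complex"
  have "(\<Sum>j<length vs. laplacian G vs $$ (i, j) * x j)
    = (\<Sum>j<length vs. (if j = i then of_nat (out_degree G (vs ! i)) * x j else 0) - ?a j * x j)"
    using i by (intro sum.cong refl) (auto simp: laplacian_def mat_diag_def left_diff_distrib)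
  also have "\<dots> = (\<Sum>j<length vs. ?a j) * x i - (\<Sum>j<length vs. ?a j * x j)"
    using i by (simp add: sum_subtractf out_degree_eq_sum[OF assms(1-3)])
  also have "\<dots> = (\<Sum>j<length vs. of_real (if (vs ! i, vs ! j) \<in> arcs_ends G then 1 else 0) * (x i - x j))"
    unfolding sum_distrib_right sum_subtractf[symmetric] by (intro sum.cong refl) auto
  finally show ?thesis .
qed

lemma adjacent_scc_of_eq:
  assumes "graph G" "(u, v) \<in> arcs_ends G"
  shows "pre_digraph.scc_of G u = pre_digraph.scc_of G v"
proof -
  interpret graph G by fact
  show ?thesis using assms(2) by (intro scc_of_eq scc_ofI_reachable) (rule reachable_adjI)
qed

text \<open>A kernel vector agrees at the ends of each edge, and equality propagates along a path
  between two vertices of a component.\<close>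

lemma laplacian_kernel_const:
  assumes G: "graph G" "distinct vs" "set vs = verts G"
    and ker: "\<And>i. i < length vs \<Longrightarrow> (\<Sum>j<length vs. laplacian G vs $$ (i, j) * x j) = 0"
    and ij: "i < length vs" "j < length vs"
      "pre_digraph.scc_of G (vs ! i) = pre_digraph.scc_of G (vs ! j)"
  shows "x i = x j"
proof -
  interpret graph G by fact
  let ?n = "length vs"
  have edge: "x s = x t" if "s < ?n" "t < ?n" "(vs ! s, vs ! t) \<in> arcs_ends G" for s t
  proof (rule laplacian_kernel_edge[where n = ?n and i = s and j = t
        and a = "\<lambda>i j. if (vs ! i, vs ! j) \<in> arcs_ends G then 1 else 0"])
    show "(if (vs ! i, vs ! j) \<in> arcs_ends G then 1 else 0) = (if (vs ! j, vs ! i) \<in> arcs_ends G then 1 else 0 :: real)"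
      for i j using arcs_ends_symmetric[OF sym_arcs] by auto
    show "(\<Sum>j<?n. of_real (if (vs ! i, vs ! j) \<in> arcs_ends G then 1 else 0) * (x i - x j)) = 0"
      if "i < ?n" for i using ker[OF that] unfolding laplacian_mult_index[OF G that] .
  qed (use that in simp_all)
  have "vs ! i \<in> scc_of (vs ! i)" by (rule in_scc_of_self) (use nth_mem[OF ij(1)] G(3) in simp)
  then have "vs ! j \<rightarrow>\<^sup>*\<^bsub>G\<^esub> vs ! i" using ij(3) by (auto simp: scc_of_def)
  then have "(vs ! j, vs ! i) \<in> (arcs_ends G)\<^sup>*" by (rule reachable_rtranclI)
  \<comment> \<open>The path runs through vertices while \<open>x\<close> is indexed by positions;
    quantifying over positions makes the induction go through, with \<open>distinct vs\<close>
    settling its start.\<close>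
  then have "\<forall>s<?n. vs ! s = vs ! i \<longrightarrow> x s = x j"
  proof (induction "vs ! i" arbitrary: i rule: rtrancl_induct)
    case base
    then show ?case using nth_eq_iff_index_eq[OF G(2) _ ij(2)] by auto
  next
    case (step v)
    have "v \<in> verts G" using step(2) by (auto simp: arcs_ends_conv)
    then obtain t where "t < ?n" "vs ! t = v" using G(3) by (metis in_set_conv_nth)
    then show ?case using step edge by metis
  qed
  then show ?thesis using ij(1) by blast
qed

text \<open>Adjacent vertices share a component, so in the difference form every term of the sum is
  zero.\<close>

lemma laplacian_mult_component:
  assumes G: "graph G" "distinct vs" "set vs = verts G" and i: "i < length vs"
  shows "(\<Sum>j<length vs. laplacian G vs $$ (i, j) *
    (if pre_digraph.scc_of G (vs ! j) = c then 1 else 0)) = 0"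
  unfolding laplacian_mult_index[OF G i]
  by (intro sum.neutral) (auto dest: adjacent_scc_of_eq[OF G(1)])

section \<open>From the spectral decomposition to \<open>component_frame\<close>\<close>

lemma mat_adjoint_carrier: "A \<in> carrier_mat n m \<Longrightarrow> mat_adjoint A \<in> carrier_mat m n"
  by (auto simp: mat_adjoint_def)

lemma mat_adjoint_index:
  fixes A :: "complex mat"
  assumes "A \<in> carrier_mat n m" "i < m" "j < n"
  shows "mat_adjoint A $$ (i, j) = cnj (A $$ (j, i))"
  using assms by (auto simp: mat_adjoint_def mat_of_rows_def)

lemma mat_mult_index_sum:
  assumes "A \<in> carrier_mat n m" "B \<in> carrier_mat m l" "i < n" "j < l"
  shows "(A * B) $$ (i, j) = (\<Sum>p<m. A $$ (i, p) * B $$ (p, j))"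
  using assms by (auto simp: scalar_prod_def lessThan_atLeast0)

lemma LG_frame_entries:
  assumes "LG_frame G vs n m \<Phi>"
  obtains U ev where
    "\<And>p q. p < m \<Longrightarrow> q < m \<Longrightarrow> (\<Sum>i<n. cnj (U i p) * U i q) = (if p = q then 1 else 0)"
    and "\<And>p. p < m \<Longrightarrow> ev p \<noteq> (0 :: real)"
    and "\<And>i j. i < n \<Longrightarrow> j < n \<Longrightarrow>
      laplacian G vs $$ (i, j) = (\<Sum>p<m. U i p * of_real (ev p) * cnj (U j p))"
    and "\<Phi> = map (\<lambda>i. vec m (\<lambda>p. of_real (sqrt (ev p)) * cnj (U i p))) [0..<n]"
proof -
  have mn: "m \<le> n" using assms unfolding LG_frame_def by blast
  obtain M :: "complex mat" and ev :: "nat \<Rightarrow> real" where M: "unitary_mat n M"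
    and ev: "\<forall>i<m. ev i \<noteq> 0"
    and lap: "laplacian G vs =
      M * mat_diag n (\<lambda>i. if i < m then complex_of_real (ev i) else 0) * mat_adjoint M"
    and Phi: "\<Phi> = map (\<lambda>i. (mat_diag m (\<lambda>i. complex_of_real (sqrt (ev i))) *
      mat_adjoint (mat n m (\<lambda>(i, j). M $$ (i, j)))) *\<^sub>v unit_vec n i) [0..<n]"
    using assms unfolding LG_frame_def Let_def by blast
  have Mc: "M \<in> carrier_mat n n" and MM: "mat_adjoint M * M = 1\<^sub>m n"
    using M unfolding unitary_mat_def by auto
  note Ma = mat_adjoint_carrier[OF Mc]
  define U where "U i p = M $$ (i, p)" for i p
  define M1 where "M1 = mat n m (\<lambda>(i, j). M $$ (i, j))"
  have M1: "M1 \<in> carrier_mat n m" by (simp add: M1_def)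
  have M1_index: "M1 $$ (i, p) = U i p" if "i < n" "p < m" for i p
    using that by (simp add: M1_def U_def)
  have "(\<Sum>i<n. cnj (U i p) * U i q) = (if p = q then 1 else 0)" if "p < m" "q < m" for p q
  proof -
    have "(mat_adjoint M * M) $$ (p, q) = (\<Sum>i<n. mat_adjoint M $$ (p, i) * M $$ (i, q))"
      using that mn by (intro mat_mult_index_sum[OF Ma Mc]) auto
    also have "\<dots> = (\<Sum>i<n. cnj (U i p) * U i q)"
      using that mn by (intro sum.cong refl) (simp add: mat_adjoint_index[OF Mc] U_def)
    finally show ?thesis using that mn unfolding MM by simp
  qed
  moreover have "laplacian G vs $$ (i, j) = (\<Sum>p<m. U i p * of_real (ev p) * cnj (U j p))"
    if "i < n" "j < n" for i j
  proof -
    let ?d = "\<lambda>i. if i < m then complex_of_real (ev i) else 0"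
    have MD: "M * mat_diag n ?d = mat n n (\<lambda>(i, j). M $$ (i, j) * ?d j)"
      by (rule mat_diag_mult_right[OF Mc])
    have "laplacian G vs $$ (i, j)
      = (\<Sum>p<n. mat n n (\<lambda>(i, j). M $$ (i, j) * ?d j) $$ (i, p) * mat_adjoint M $$ (p, j))"
      unfolding lap MD using that by (intro mat_mult_index_sum[OF _ Ma]) auto
    \<comment> \<open>The zero eigenvalues discard all but the first \<open>m\<close> columns of
      \<open>M\<close>.\<close>
    also have "\<dots> = (\<Sum>p<n. if p \<in> {..<m} then U i p * of_real (ev p) * cnj (U j p) else 0)"
      using that by (intro sum.cong refl) (simp add: mat_adjoint_index[OF Mc] U_def)
    also have "\<dots> = (\<Sum>p\<in>{..<n} \<inter> {..<m}. U i p * of_real (ev p) * cnj (U j p))"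
      by (rule sum.inter_restrict[symmetric]) simp
    also have "{..<n} \<inter> {..<m} = {..<m}" using mn by auto
    finally show ?thesis .
  qed
  moreover have "\<Phi> = map (\<lambda>i. vec m (\<lambda>p. of_real (sqrt (ev p)) * cnj (U i p))) [0..<n]"
    unfolding Phi M1_def[symmetric]
  proof (intro map_cong refl)
    fix i assume "i \<in> set [0..<n]"
    then have i: "i < n" by simp
    have B: "mat_diag m (\<lambda>i. complex_of_real (sqrt (ev i))) * mat_adjoint M1
      = mat m n (\<lambda>(p, i). of_real (sqrt (ev p)) * mat_adjoint M1 $$ (p, i))"
      by (rule mat_diag_mult_left[OF mat_adjoint_carrier[OF M1]])
    show "mat_diag m (\<lambda>i. complex_of_real (sqrt (ev i))) * mat_adjoint M1 *\<^sub>v unit_vec n i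
      = vec m (\<lambda>p. of_real (sqrt (ev p)) * cnj (U i p))"
      unfolding B using i
      by (intro eq_vecI) (simp_all add: mat_adjoint_index[OF M1] M1_index)
  qed
  ultimately show ?thesis using that ev by blast
qed
lemma LG_frame_component_frame:
  assumes G: "graph G" "distinct vs" "set vs = verts G" "length vs = n"
    and LG: "LG_frame G vs n m \<Phi>" and m: "0 < m"
  shows "\<exists>\<Theta>. component_frame m n \<Phi> \<Theta> (\<lambda>i. pre_digraph.scc_of G (vs ! i))"
proof -
  obtain U ev where
    orth: "\<And>p q. p < m \<Longrightarrow> q < m \<Longrightarrow> (\<Sum>i<n. cnj (U i p) * U i q) = (if p = q then 1 else 0)"
    and ev: "\<And>p. p < m \<Longrightarrow> ev p \<noteq> (0 :: real)"
    and lap: "\<And>i j. i < n \<Longrightarrow> j < n \<Longrightarrow>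
      laplacian G vs $$ (i, j) = (\<Sum>p<m. U i p * of_real (ev p) * cnj (U j p))"
    and Phi: "\<Phi> = map (\<lambda>i. vec m (\<lambda>p. of_real (sqrt (ev p)) * cnj (U i p))) [0..<n]"
    by (rule LG_frame_entries[OF LG], rule that)
  define s where "s p = complex_of_real (sqrt (ev p))" for p
  have s0: "s p \<noteq> 0" if "p < m" for p using ev[OF that] by (simp add: s_def)
  have s_cnj: "cnj (s p) = s p" for p by (simp add: s_def)
  let ?comp = "\<lambda>i. pre_digraph.scc_of G (vs ! i)"
  \<comment> \<open>Dividing by \<open>s p\<close> where \<open>\<Phi>\<close> multiplies by it
    makes the scalings cancel in the cross Gram matrix. What remains is the projection onto the span
    of the columns of \<open>U\<close>.\<close>
  define \<Theta> where "\<Theta> = map (\<lambda>i. vec m (\<lambda>p. cnj (U i p) / s p)) [0..<n]"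
  have Pi: "\<Phi> ! i $ p = s p * cnj (U i p)" if "i < n" "p < m" for i p
    using that by (simp add: Phi s_def)
  have Ti: "\<Theta> ! i $ p = cnj (U i p) / s p" if "i < n" "p < m" for i p
    using that by (simp add: \<Theta>_def)
  have Pc: "\<Phi> ! i \<in> carrier_vec m" if "i < n" for i
    using that by (simp add: Phi)
  have "component_frame m n \<Phi> \<Theta> ?comp"
  proof
    show "length \<Phi> = n" "length \<Theta> = n" by (simp_all add: Phi \<Theta>_def)
    show "set \<Phi> \<subseteq> carrier_vec m" "set \<Theta> \<subseteq> carrier_vec m" by (auto simp: Phi \<Theta>_def)
    show "biorthogonal m \<Phi> \<Theta>"
      unfolding biorthogonal_def
    proof (intro allI impI)
      fix p q assume pq: "p < m" "q < m"
      have "(\<Sum>i<n. cnj (\<Phi> ! i $ q) * \<Theta> ! i $ p) = (\<Sum>i<n. s q / s p * (cnj (U i p) * U i q))"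
        using pq by (intro sum.cong refl) (simp add: Pi Ti s_cnj)
      also have "\<dots> = s q / s p * (if p = q then 1 else 0)"
        using pq by (simp only: sum_distrib_left[symmetric] orth)
      also have "\<dots> = (if p = q then 1 else 0)" using s0[OF pq(1)] by auto
      finally show "(\<Sum>i<length \<Phi>. cnj (\<Phi> ! i $ q) * \<Theta> ! i $ p) = (if p = q then 1 else 0)"
        by (simp add: Phi)
    qed
    fix i j assume ij: "i < n" "j < n"
    have "\<Theta> ! j \<bullet>c \<Phi> ! i = (\<Sum>p<m. U i p * cnj (U j p))"
      unfolding cscalar_sum[OF Pc[OF ij(1)]]
      using ij s0 by (intro sum.cong refl) (simp add: Pi Ti s_cnj)
    also have "\<dots> = (if i = j then 1 else 0)
      - (if ?comp i = ?comp j then 1 / of_nat (card {l. l < n \<and> ?comp l = ?comp i}) else 0)"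
    proof (rule projection_gram[where L = "\<lambda>i j. laplacian G vs $$ (i, j)" and ev = "\<lambda>p. of_real (ev p)",
          OF orth lap])
      show "x k = x l" if "\<And>i. i < n \<Longrightarrow> (\<Sum>j<n. laplacian G vs $$ (i, j) * x j) = 0"
        "k < n" "l < n" "?comp k = ?comp l" for x k l
        using laplacian_kernel_const[OF G(1-3), of x k l] that unfolding G(4) by blast
      show "(\<Sum>j<n. laplacian G vs $$ (i, j) * (if ?comp j = c then 1 else 0)) = 0" if "i < n" for c i
        using laplacian_mult_component[OF G(1-3), of i c] that unfolding G(4) by blast
    qed (use ev ij in simp_all)
    finally show "\<Theta> ! j \<bullet>c \<Phi> ! i = (if i = j then 1 else 0)
      - (if ?comp i = ?comp j then 1 / of_nat (card {l. l < n \<and> ?comp l = ?comp i}) else 0)" .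
  qed (rule m)
  then show ?thesis by blast
qed

text \<open>Members of \<open>sccs\<close> are subgraphs, whereas the labels are vertex sets; the
  two are equinumerous by \<open>card_sccs_verts\<close>.\<close>

lemma card_image_scc_of_nth:
  assumes "graph G" "set vs = verts G"
  shows "card ((\<lambda>i. pre_digraph.scc_of G (vs ! i)) ` {..<length vs}) = card (pre_digraph.sccs G)"
proof -
  interpret graph G by fact
  have "(!) vs ` {..<length vs} = verts G"
    using assms(2) by (auto simp: set_conv_nth)
  then have "(\<lambda>i. scc_of (vs ! i)) ` {..<length vs} = sccs_verts"
    unfolding sccs_verts_conv_scc_of by (metis image_image)
  then show ?thesis using card_sccs_verts by simp
qed

theorem theorem3p6:
  fixes G :: "('a, 'b) pre_digraph" and vs :: "'a list"
    and n k r :: nat and \<Phi> :: "complex vec list"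
  assumes "graph G" and "distinct vs" and "set vs = verts G" and "length vs = n"
    and "card (pre_digraph.sccs G) = k" and "1 < k" and "k < n"
    and "LG_frame G vs n (n - k) \<Phi>"
    and "r \<in> {1..n - 1}"
  shows "SOD_frame (n - k) \<Phi> r (canonical_dual (n - k) \<Phi>) \<and>
         (\<exists>\<Psi> \<in> dual_frames (n - k) \<Phi>. \<Psi> \<noteq> canonical_dual (n - k) \<Phi> \<and>
            SOD_frame (n - k) \<Phi> r \<Psi>)"
proof -
  define comp where "comp i = pre_digraph.scc_of G (vs ! i)" for i
  have "0 < n - k" using assms(7) by simp
  then obtain \<Theta> where "component_frame (n - k) n \<Phi> \<Theta> comp"
    using LG_frame_component_frame[OF assms(1-4,8)] unfolding comp_def by blast
  then interpret component_frame "n - k" n \<Phi> \<Theta> comp .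
  have card: "card (comp ` {..<n}) = k"
    using card_image_scc_of_nth[OF assms(1,3)] assms(4,5) unfolding comp_def by simp
  \<comment> \<open>Pigeonhole: \<open>n\<close> indices carry only \<open>k < n\<close> labels, so
    some component contains two of them.\<close>
  have "\<not> inj_on comp {..<n}"
    using card_image[of comp "{..<n}"] card assms(7) by auto
  then obtain i j where ij: "i < n" "j < n" "i \<noteq> j" "comp i = comp j"
    by (auto simp: inj_on_def)
  \<comment> \<open>A second component must exist to carry the perturbation that gives another
    optimal dual.\<close>
  have "\<exists>l<n. comp l \<noteq> comp i"
  proof (rule ccontr)
    assume "\<not> ?thesis"
    then have "comp ` {..<n} \<subseteq> {comp i}" by auto
    then have "card (comp ` {..<n}) \<le> card {comp i}" by (intro card_mono) auto
    then show False using card assms(6) by simp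
  qed
  then obtain l where l: "l < n" "comp l \<noteq> comp i" by blast
  have r: "1 \<le> r" "r < n" using assms(7,9) by auto
  show ?thesis
    unfolding canonical_dual_eq using Theta_SOD_frame[OF ij r] ex_other_SOD_frame[OF ij l r] by blast
qed

end
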